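(* Let $d\in\{2,3\}$, let $\Omega\subset\mathbb{R}^d$, the triangulation $\mathcal{T}_h$, the finite element spaces $\mathcal{V}_h,\mathcal{X}_h,\mathcal{Q}_h,\mathcal{W}_h,\mathcal{Z}_h$, the time grid $\mathcal{I}_\tau=\{t^0,\dots,t^{n_T}\}$ with step size $\tau>0$, the time-discrete spaces $\Pi^1_c,\Pi^0$, the difference quotient $d_\tau^{n+1}$, the averaged derivative $f'(\cdot,\cdot)$, the form $\mathbf{c}_{skw}$, and the energies $E_0,E_1$ be as in the context. Let $\gamma>0$, let $f\in C^1(\mathbb{R})$, and let $m,\alpha,\eta:\mathbb{R}\to\mathbb{R}$ be continuous. Then the following hold. **(CH)** Let $\phi_h^0\in\mathcal{V}_h$ be given and let $(\phi_h,\mu_h)\in\Pi^1_c(\mathcal{I}_\tau;\mathcal{V}_h)\times\Pi^0(\mathcal{I}_\tau;\mathcal{V}_h)$, with $\phi_h(t^0)=\phi_h^0$, satisfy for all $(\psi_h,\xi_h)\in\mathcal{V}_h\times\mathcal{V}_h$ and all $0\le n<n_T$ $$\langle d_\tau^{n+1}\phi_h,\psi_h\rangle+\langle m(\phi_h^{n+1})\nabla\mu_h^{n+1},\nabla\psi_h\rangle=0,$$ $$\langle\mu_h^{n+1},\xi_h\rangle-\gamma\langle\nabla\phi_h^{n+1},\nabla\xi_h\rangle-\langle f'(\phi_h^{n+1},\phi_h^n),\xi_h\rangle=0.$$ Then for all $0\le n<n_T$: $\langle\phi_h^{n+1},1\rangle=\langle\phi_h^n,1\rangle$ and $$E_0(\phi_h^{n+1})+\tau\langle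 m(\phi_h^{n+1})\nabla\mu_h^{n+1},\nabla\mu_h^{n+1}\rangle\le E_0(\phi_h^n).$$ **(CHD)** Let $\phi_h^0\in\mathcal{V}_h$ be given and let $\phi_h\in\Pi^1_c(\mathcal{I}_\tau;\mathcal{V}_h)$, with $\phi_h(t^0)=\phi_h^0$, and $(\mu_h,\boldsymbol{v}_h,p_h)\in\Pi^0(\mathcal{I}_\tau;\mathcal{V}_h\times\mathcal{Z}_h\times\mathcal{W}_h)$ satisfy for all $(\psi_h,\xi_h,\mathbf{w}_h,q_h)\in\mathcal{V}_h\times\mathcal{V}_h\times\mathcal{Z}_h\times\mathcal{W}_h$ and all $0\le n<n_T$ $$\langle d_\tau^{n+1}\phi_h,\psi_h\rangle-\langle\phi_h^{n+1}\boldsymbol{v}_h^{n+1},\nabla\psi_h\rangle+\langle m(\phi_h^{n+1})\nabla\mu_h^{n+1},\nabla\psi_h\rangle=0,$$ $$\langle\mu_h^{n+1},\xi_h\rangle-\gamma\langle\nabla\phi_h^{n+1},\nabla\xi_h\rangle-\langle f'(\phi_h^{n+1},\phi_h^n),\xi_h\rangle=0,$$ $$\langle\alpha(\phi_h^{n+1})\boldsymbol{v}_h^{n+1},\mathbf{w}_h\rangle-\langle p_h^{n+1},\operatorname{div}\mathbf{w}_h\rangle+\langle\phi_h^{n+1}\nabla\mu_h^{n+1},\mathbf{w}_h\rangle=0,$$ $$\langle\operatorname{div}\boldsymbol{v}_h^{n+1},q_h\rangle=0.$$ Then for all $0\le n<n_T$: $\langle\phi_h^{n+1},1\rangle=\langle\phi_h^n,1\rangle$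 and $$E_0(\phi_h^{n+1})+\tau\langle m(\phi_h^{n+1})\nabla\mu_h^{n+1},\nabla\mu_h^{n+1}\rangle+\tau\langle\alpha(\phi_h^{n+1})\boldsymbol{v}_h^{n+1},\boldsymbol{v}_h^{n+1}\rangle\le E_0(\phi_h^n).$$ **(CHNS)** Let $(\phi_h^0,\boldsymbol{v}_h^0)\in\mathcal{V}_h\times\mathcal{X}_h$ be given and let $(\phi_h,\boldsymbol{v}_h)\in\Pi^1_c(\mathcal{I}_\tau;\mathcal{V}_h\times\mathcal{X}_h)$, with $(\phi_h,\boldsymbol{v}_h)(t^0)=(\phi_h^0,\boldsymbol{v}_h^0)$, and $(\mu_h,p_h)\in\Pi^0(\mathcal{I}_\tau;\mathcal{V}_h\times\mathcal{Q}_h)$ satisfy for all $(\psi_h,\xi_h,\mathbf{w}_h,q_h)\in\mathcal{V}_h\times\mathcal{V}_h\times\mathcal{X}_h\times\mathcal{Q}_h$ and all $0\le n<n_T$ $$\langle d_\tau^{n+1}\phi_h,\psi_h\rangle-\langle\phi_h^{n+1}\boldsymbol{v}_h^{n+1},\nabla\psi_h\rangle+\langle m(\phi_h^{n+1})\nabla\mu_h^{n+1},\nabla\psi_h\rangle=0,$$ $$\langle\mu_h^{n+1},\xi_h\rangle-\gamma\langle\nabla\phi_h^{n+1},\nabla\xi_h\rangle-\langle f'(\phi_h^{n+1},\phi_h^n),\xi_h\rangle=0,$$ $$\langle d_\tau^{n+1}\boldsymbol{v}_h,\mathbf{w}_h\rangle+\mathbf{c}_{skw}(\boldsymbol{v}_h^{n+1},\boldsymbol{v}_h^{n+1},\mathbf{w}_h)+\langle\eta(\phi_h^{n+1})\mathrm{D}\boldsymbol{v}_h^{n+1},\mathrm{D}\mathbf{w}_h\rangle-\langle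 p_h^{n+1},\operatorname{div}\mathbf{w}_h\rangle+\langle\phi_h^{n+1}\nabla\mu_h^{n+1},\mathbf{w}_h\rangle=0,$$ $$\langle\operatorname{div}\boldsymbol{v}_h^{n+1},q_h\rangle=0.$$ Then for all $0\le n<n_T$: $\langle\phi_h^{n+1},1\rangle=\langle\phi_h^n,1\rangle$ and $$E_1(\phi_h^{n+1},\boldsymbol{v}_h^{n+1})+\tau\langle m(\phi_h^{n+1})\nabla\mu_h^{n+1},\nabla\mu_h^{n+1}\rangle+\tau\langle\eta(\phi_h^{n+1})\mathrm{D}\boldsymbol{v}_h^{n+1},\mathrm{D}\boldsymbol{v}_h^{n+1}\rangle\le E_1(\phi_h^n,\boldsymbol{v}_h^n).$$
   Context: **Domain and mesh.** $\Omega\subset\mathbb{R}^d$ ($d=2,3$) is a (bounded) convex polyhedral domain and $\mathcal{T}_h$ is a globally quasi-uniform (simplicial) triangulation of $\Omega$. Periodic boundary conditions are imposed: $\Omega$ is a fundamental cell of a lattice of translations, opposite faces are identified (the triangulation being compatible with this), and $H^1(\Omega)$, as well as the space of $L^2$ vector fields with $L^2$ divergence, are understood as the corresponding spaces of periodic functions. $\langle\cdot,\cdot\rangle$ denotes the $L^2(\Omega)$ inner product of scalar-, vector- or matrix-valued functions. $\mathrm{D}\boldsymbol{v}=\tfrac12(\nabla\boldsymbol{v}+\nabla\boldsymbol{v}^\top)$ is the symmetric gradient. **Finite element spaces.** With $\mathbb{P}_k(K)$ the polynomials of degree at most $k$ on $K$, let $\mathbb{P}_k=\{v\in L^2(\Omega):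 v|_K\in\mathbb{P}_k(K)\ \forall K\in\mathcal{T}_h\}$ and $\mathbb{P}_k^c=\{v\in H^1(\Omega): v|_K\in\mathbb{P}_k(K)\ \forall K\in\mathcal{T}_h\}$. Set $$\mathcal{V}_h=\mathbb{P}_1^c,\quad \mathcal{X}_h=(\mathbb{P}_2^c)^d,\quad \mathcal{Q}_h=\mathbb{P}_1^c,\quad \mathcal{W}_h=\mathbb{P}_1,$$ $$\mathcal{Z}_h=\{\mathbf{v}\in[L^2(\Omega)]^d:\ \nabla\cdot\mathbf{v}\in L^2(\Omega),\ \mathbf{v}|_K\in[\mathbb{P}_2(K)]^d\ \forall K\in\mathcal{T}_h\}.$$ **Time discretisation.** $T>0$ is fixed, $\tau>0$ is a uniform step size with $n_T=T/\tau\in\mathbb{N}$, $t^n=n\tau$, $\mathcal{I}_\tau=\{0=t^0,t^1,\dots,t^{n_T}=T\}$, $I_n=(t^n,t^{n+1})$. For a function space $X$, $\Pi^1_c(\mathcal{I}_\tau;X)$ is the space of continuous functions $[0,T]\to X$ that are affine on each $I_n$, and $\Pi^0(\mathcal{I}_\tau;X)$ is the space of $X$-valued functions that are constant on each $I_n$. For $g\in\Pi^1_c(\mathcal{I}_\tau;X)$, $g^n=g(t^n)$; for $g\in\Pi^0(\mathcal{I}_\tau;X)$, $g^{n+1}$ is the value of $g$ on $I_n$. The discrete time derivative is $d_\tau^{n+1}g=\frac{g^{n+1}-g^n}{\tau}$. **Averaged potential derivative.** $$f'(\phi^{n+1},\phi^n):=\frac1\tau\int_{t^n}^{t^{n+1}}f'\big(\phi^{n,n+1}_{\mathrm{avg}}(s)\big)\,\mathrm{d}s,\qquad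 \phi^{n,n+1}_{\mathrm{avg}}(s)=\frac{\phi^{n+1}-\phi^n}{\tau}(s-t^n)+\phi^n,$$ evaluated pointwise in $x\in\Omega$, where $f'$ with one argument is the ordinary derivative of $f$. **Skew-symmetric convective form.** $$\mathbf{c}_{skw}(\boldsymbol{v}^*,\boldsymbol{v},\mathbf{w})=\tfrac12\langle(\boldsymbol{v}^*\cdot\nabla)\boldsymbol{v},\mathbf{w}\rangle-\tfrac12\langle(\boldsymbol{v}^*\cdot\nabla)\mathbf{w},\boldsymbol{v}\rangle.$$ **Energies.** $$E_0(\phi)=\int_\Omega\frac{\gamma}{2}|\nabla\phi|^2+f(\phi)\,\mathrm{d}x,\qquad E_1(\phi,\boldsymbol{v})=\int_\Omega\frac{\gamma}{2}|\nabla\phi|^2+f(\phi)+\frac12|\boldsymbol{v}|^2\,\mathrm{d}x.$$ **Roles of the quantities.** $\phi_h$ is the phase field, $\mu_h$ the chemical potential, $\boldsymbol{v}_h$ the velocity, $p_h$ the pressure, $m$ the mobility, $\alpha$ the Darcy drag coefficient, $\eta$ the viscosity, $f$ the bulk free energy density. *)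

theory Defs
  imports "HOL-Analysis.Analysis"
begin

section \<open>Periodic meshes\<close>

definition is_lattice :: "(real^'d) set \<Rightarrow> bool" where
  "is_lattice \<Lambda> \<longleftrightarrow>
    (\<exists>b :: 'd \<Rightarrow> real^'d. inj b \<and> independent (range b) \<and>
       \<Lambda> = {(\<Sum>i\<in>UNIV. of_int (k i) *\<^sub>R b i) | k. True})"

text \<open>The last conjunct says that the lattice identifies the facets in pairs. Two parallel facets
  of a convex cell that differ by a nonzero translation are opposite to each other.\<close>

definition fundamental_cell :: "(real^'d) set \<Rightarrow> (real^'d) set \<Rightarrow> bool" where
  "fundamental_cell \<Lambda> \<Omega> \<longleftrightarrow>
    (\<forall>l\<in>\<Lambda>. l \<noteq> 0 \<longrightarrow> (+) l ` \<Omega> \<inter> \<Omega> = {}) \<and>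
    (\<Union>l\<in>\<Lambda>. (+) l ` closure \<Omega>) = UNIV \<and>
    (\<forall>F. F facet_of closure \<Omega> \<longrightarrow> (\<exists>l\<in>\<Lambda>. l \<noteq> 0 \<and> (+) l ` F facet_of closure \<Omega>))"

definition periodic_domain :: "(real^'d) set \<Rightarrow> (real^'d) set \<Rightarrow> bool" where
  "periodic_domain \<Lambda> \<Omega> \<longleftrightarrow>
    open \<Omega> \<and> \<Omega> \<noteq> {} \<and> bounded \<Omega> \<and> convex \<Omega> \<and> polyhedron (closure \<Omega>) \<and>
    is_lattice \<Lambda> \<and> fundamental_cell \<Lambda> \<Omega>"

definition mesh_size :: "(real^'d) set set \<Rightarrow> real" where
  "mesh_size Th = Max (diameter ` Th)"

text \<open>The constant \<open>\<sigma>\<close> is the one that is uniform over a globally quasi-uniform family of meshes.\<close>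

definition quasi_uniform :: "real \<Rightarrow> (real^'d) set set \<Rightarrow> bool" where
  "quasi_uniform \<sigma> Th \<longleftrightarrow> (\<forall>K\<in>Th. \<exists>x. cball x (\<sigma> * mesh_size Th) \<subseteq> K)"

text \<open>The last conjunct says that the lattice translates of the mesh form a conforming
  triangulation of the whole space, which is the compatibility with the identification of
  opposite faces.\<close>

definition periodic_triangulation ::
  "(real^'d) set \<Rightarrow> (real^'d) set \<Rightarrow> (real^'d) set set \<Rightarrow> bool" where
  "periodic_triangulation \<Lambda> \<Omega> Th \<longleftrightarrow>
    triangulation Th \<and> (\<forall>K\<in>Th. int CARD('d) simplex K) \<and> \<Union>Th = closure \<Omega> \<and>
    (\<forall>l\<in>\<Lambda>. \<forall>K\<in>Th. \<forall>K'\<in>Th.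
       ((+) l ` K \<inter> K') face_of (+) l ` K \<and> ((+) l ` K \<inter> K') face_of K')"


section \<open>Lebesgue spaces and weak derivatives\<close>

text \<open>Elements of Lebesgue spaces are represented by functions on the whole space; two functions
  represent the same element of a space over \<open>S\<close> iff they agree almost everywhere on \<open>S\<close>.\<close>

definition square_integrable :: "(real^'d) set \<Rightarrow> (real^'d \<Rightarrow> 'b::euclidean_space) \<Rightarrow> bool" where
  "square_integrable S u \<longleftrightarrow>
    u \<in> borel_measurable (lebesgue_on S) \<and> integrable (lebesgue_on S) (\<lambda>x. (norm (u x))\<^sup>2)"

text \<open>On \<open>real^'d^'d\<close> the inner product \<open>\<bullet>\<close> is the Frobenius inner product.\<close>

definition l2 :: "(real^'d) set \<Rightarrow> (real^'d \<Rightarrow> 'b::euclidean_space) \<Rightarrow> (real^'d \<Rightarrow> 'b) \<Rightarrow> real" where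
  "l2 \<Omega> u w = (LINT x|lebesgue_on \<Omega>. u x \<bullet> w x)"

definition l2_norm :: "(real^'d) set \<Rightarrow> (real^'d \<Rightarrow> 'b::euclidean_space) \<Rightarrow> real" where
  "l2_norm \<Omega> u = sqrt (l2 \<Omega> u u)"

definition l2_loc :: "(real^'d \<Rightarrow> 'b::euclidean_space) \<Rightarrow> bool" where
  "l2_loc u \<longleftrightarrow> (\<forall>S. compact S \<longrightarrow> square_integrable S u)"

definition periodic :: "(real^'d) set \<Rightarrow> (real^'d \<Rightarrow> 'b::euclidean_space) \<Rightarrow> bool" where
  "periodic \<Lambda> u \<longleftrightarrow> (\<forall>l\<in>\<Lambda>. AE x in lebesgue. u (l + x) = u x)"

definition gradient :: "(real^'d \<Rightarrow> real) \<Rightarrow> real^'d \<Rightarrow> real^'d" where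
  "gradient \<psi> x = (\<chi> i. frechet_derivative \<psi> (at x) (axis i 1))"

primrec Ck :: "nat \<Rightarrow> (real^'d \<Rightarrow> real) \<Rightarrow> bool" where
  "Ck 0 \<psi> \<longleftrightarrow> continuous_on UNIV \<psi>"
| "Ck (Suc k) \<psi> \<longleftrightarrow> (\<forall>x. \<psi> differentiable at x) \<and> (\<forall>i. Ck k (\<lambda>x. gradient \<psi> x $ i))"

definition test_function :: "(real^'d \<Rightarrow> real) \<Rightarrow> bool" where
  "test_function \<psi> \<longleftrightarrow> (\<forall>k. Ck k \<psi>) \<and> compact (closure {x. \<psi> x \<noteq> 0})"

definition has_weak_gradient :: "(real^'d \<Rightarrow> real) \<Rightarrow> (real^'d \<Rightarrow> real^'d) \<Rightarrow> bool" where
  "has_weak_gradient u g \<longleftrightarrow>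
    (\<forall>\<psi>. test_function \<psi> \<longrightarrow>
       (LINT x|lebesgue. u x *\<^sub>R gradient \<psi> x) = - (LINT x|lebesgue. \<psi> x *\<^sub>R g x))"

definition has_weak_divergence :: "(real^'d \<Rightarrow> real^'d) \<Rightarrow> (real^'d \<Rightarrow> real) \<Rightarrow> bool" where
  "has_weak_divergence v w \<longleftrightarrow>
    (\<forall>\<psi>. test_function \<psi> \<longrightarrow>
       (LINT x|lebesgue. v x \<bullet> gradient \<psi> x) = - (LINT x|lebesgue. \<psi> x * w x))"

text \<open>Weak derivatives in \<open>l2_loc\<close> are unique up to null sets, so the choices below are immaterial.\<close>

definition weak_grad :: "(real^'d \<Rightarrow> real) \<Rightarrow> real^'d \<Rightarrow> real^'d" where
  "weak_grad u = (SOME g. l2_loc g \<and> has_weak_gradient u g)"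

definition weak_div :: "(real^'d \<Rightarrow> real^'d) \<Rightarrow> real^'d \<Rightarrow> real" where
  "weak_div v = (SOME w. l2_loc w \<and> has_weak_divergence v w)"

text \<open>Row \<open>i\<close> of the Jacobian is the gradient of the \<open>i\<close>-th component; hence
  \<open>weak_jac v x *v a x\<close> is \<open>(a \<cdot> \<nabla>)v\<close> at \<open>x\<close>.\<close>

definition weak_jac :: "(real^'d \<Rightarrow> real^'d) \<Rightarrow> real^'d \<Rightarrow> real^'d^'d" where
  "weak_jac v x = (\<chi> i. weak_grad (\<lambda>y. v y $ i) x)"

definition sym_grad :: "(real^'d \<Rightarrow> real^'d) \<Rightarrow> real^'d \<Rightarrow> real^'d^'d" where
  "sym_grad v x = (1/2) *\<^sub>R (weak_jac v x + transpose (weak_jac v x))"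

text \<open>The periodic Sobolev spaces over a fundamental cell: periodic functions that are locally in
  the Sobolev space over the whole space. In particular there are no jumps of traces (normal
  traces, respectively) across identified faces.\<close>

definition H1_per :: "(real^'d) set \<Rightarrow> (real^'d \<Rightarrow> real) set" where
  "H1_per \<Lambda> = {u. periodic \<Lambda> u \<and> l2_loc u \<and> (\<exists>g. l2_loc g \<and> has_weak_gradient u g)}"

definition Hdiv_per :: "(real^'d) set \<Rightarrow> (real^'d \<Rightarrow> real^'d) set" where
  "Hdiv_per \<Lambda> = {v. periodic \<Lambda> v \<and> l2_loc v \<and> (\<exists>w. l2_loc w \<and> has_weak_divergence v w)}"


section \<open>Finite element spaces\<close>

lemma finite_multi_indices: "finite {\<alpha> :: 'd::finite \<Rightarrow> nat. sum \<alpha> UNIV \<le> k}"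
proof -
  have "\<alpha> i \<le> k" if "sum \<alpha> UNIV \<le> k" for \<alpha> :: "'d \<Rightarrow> nat" and i
    using member_le_sum[of i UNIV \<alpha>] that by (meson UNIV_I finite order_trans zero_le)
  then have "{\<alpha> :: 'd \<Rightarrow> nat. sum \<alpha> UNIV \<le> k} \<subseteq> PiE UNIV (\<lambda>_. {..k})"
    by (auto simp: PiE_def)
  then show ?thesis
    by (rule finite_subset) (simp add: finite_PiE)
qed

definition polys :: "nat \<Rightarrow> (real^'d \<Rightarrow> real) set" where
  "polys k = {p. \<exists>c. \<forall>x. p x = (\<Sum>\<alpha> | sum \<alpha> UNIV \<le> k. c \<alpha> * (\<Prod>i\<in>UNIV. (x $ i) ^ \<alpha> i))}"

definition piecewise_poly :: "nat \<Rightarrow> (real^'d) set set \<Rightarrow> (real^'d \<Rightarrow> real) \<Rightarrow> bool" where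
  "piecewise_poly k Th u \<longleftrightarrow> (\<forall>K\<in>Th. \<exists>p\<in>polys k. AE x in lebesgue_on K. u x = p x)"

definition P_disc :: "nat \<Rightarrow> (real^'d) set \<Rightarrow> (real^'d) set set \<Rightarrow> (real^'d \<Rightarrow> real) set" where
  "P_disc k \<Omega> Th = {u. square_integrable \<Omega> u \<and> piecewise_poly k Th u}"

definition P_cont :: "nat \<Rightarrow> (real^'d) set \<Rightarrow> (real^'d) set set \<Rightarrow> (real^'d \<Rightarrow> real) set" where
  "P_cont k \<Lambda> Th = {u \<in> H1_per \<Lambda>. piecewise_poly k Th u}"

definition Vh :: "(real^'d) set \<Rightarrow> (real^'d) set set \<Rightarrow> (real^'d \<Rightarrow> real) set" where
  "Vh \<Lambda> Th = P_cont 1 \<Lambda> Th"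

definition Xh :: "(real^'d) set \<Rightarrow> (real^'d) set set \<Rightarrow> (real^'d \<Rightarrow> real^'d) set" where
  "Xh \<Lambda> Th = {v. \<forall>i. (\<lambda>x. v x $ i) \<in> P_cont 2 \<Lambda> Th}"

definition Qh :: "(real^'d) set \<Rightarrow> (real^'d) set set \<Rightarrow> (real^'d \<Rightarrow> real) set" where
  "Qh \<Lambda> Th = P_cont 1 \<Lambda> Th"

definition Wh :: "(real^'d) set \<Rightarrow> (real^'d) set set \<Rightarrow> (real^'d \<Rightarrow> real) set" where
  "Wh \<Omega> Th = P_disc 1 \<Omega> Th"

definition Zh :: "(real^'d) set \<Rightarrow> (real^'d) set set \<Rightarrow> (real^'d \<Rightarrow> real^'d) set" where
  "Zh \<Lambda> Th = {v \<in> Hdiv_per \<Lambda>. \<forall>i. piecewise_poly 2 Th (\<lambda>x. v x $ i)}"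


section \<open>Time discretisation\<close>

definition tn :: "real \<Rightarrow> nat \<Rightarrow> real" where
  "tn \<tau> n = real n * \<tau>"

text \<open>Continuity is with respect to the \<open>L\<^sup>2\<close> norm; the spaces \<open>X\<close> of interest are
  finite-dimensional, so that any norm gives the same notion.\<close>

definition Pi1c :: "(real^'d) set \<Rightarrow> real \<Rightarrow> nat \<Rightarrow> (real^'d \<Rightarrow> 'b::euclidean_space) set
    \<Rightarrow> (real \<Rightarrow> real^'d \<Rightarrow> 'b) set" where
  "Pi1c \<Omega> \<tau> N X = {g.
    (\<forall>t\<in>{0..tn \<tau> N}. g t \<in> X) \<and>
    (\<forall>s\<in>{0..tn \<tau> N}. ((\<lambda>t. l2_norm \<Omega> (\<lambda>x. g t x - g s x)) \<longlongrightarrow> 0) (at s within {0..tn \<tau> N})) \<and>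
    (\<forall>n<N. \<exists>a\<in>X. \<exists>b\<in>X. \<forall>t\<in>{tn \<tau> n<..<tn \<tau> (Suc n)}.
       AE x in lebesgue_on \<Omega>. g t x = a x + t *\<^sub>R b x)}"

definition Pi0 :: "(real^'d) set \<Rightarrow> real \<Rightarrow> nat \<Rightarrow> (real^'d \<Rightarrow> 'b::euclidean_space) set
    \<Rightarrow> (real \<Rightarrow> real^'d \<Rightarrow> 'b) set" where
  "Pi0 \<Omega> \<tau> N X = {g. \<forall>n<N. \<exists>c\<in>X. \<forall>t\<in>{tn \<tau> n<..<tn \<tau> (Suc n)}.
       g t \<in> X \<and> (AE x in lebesgue_on \<Omega>. g t x = c x)}"

text \<open>\<open>nodal \<tau> g n\<close> is \<open>g\<^sup>n\<close> for \<open>g\<close> in \<open>Pi1c\<close>. For \<open>g\<close> in \<open>Pi0\<close>, \<open>midval \<tau> g (Suc n)\<close> is the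
  value of \<open>g\<close> on the interval between \<open>tn \<tau> n\<close> and \<open>tn \<tau> (Suc n)\<close>, read off at its midpoint.\<close>

definition nodal :: "real \<Rightarrow> (real \<Rightarrow> real^'d \<Rightarrow> 'b) \<Rightarrow> nat \<Rightarrow> real^'d \<Rightarrow> 'b" where
  "nodal \<tau> g n = g (tn \<tau> n)"

definition midval :: "real \<Rightarrow> (real \<Rightarrow> real^'d \<Rightarrow> 'b) \<Rightarrow> nat \<Rightarrow> real^'d \<Rightarrow> 'b" where
  "midval \<tau> g n = g (tn \<tau> n - \<tau> / 2)"

text \<open>\<open>dtau \<tau> n g\<close> is the difference quotient with superscript \<open>n\<close>, for positive \<open>n\<close>.\<close>

definition dtau :: "real \<Rightarrow> nat \<Rightarrow> (real \<Rightarrow> real^'d \<Rightarrow> 'b::euclidean_space) \<Rightarrow> real^'d \<Rightarrow> 'b" where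
  "dtau \<tau> n g x = (nodal \<tau> g n x - nodal \<tau> g (n - 1) x) /\<^sub>R \<tau>"


section \<open>Forms, energies and schemes\<close>

text \<open>\<open>avg_deriv \<tau> f \<phi> n\<close> is \<open>f'(\<phi>\<^sup>n\<^sup>+\<^sup>1, \<phi>\<^sup>n)\<close>.\<close>

definition avg_deriv ::
  "real \<Rightarrow> (real \<Rightarrow> real) \<Rightarrow> (real \<Rightarrow> real^'d \<Rightarrow> real) \<Rightarrow> nat \<Rightarrow> real^'d \<Rightarrow> real" where
  "avg_deriv \<tau> f \<phi> n x =
    (1 / \<tau>) * integral {tn \<tau> n..tn \<tau> (Suc n)}
      (\<lambda>s. deriv f ((nodal \<tau> \<phi> (Suc n) x - nodal \<tau> \<phi> n x) / \<tau> * (s - tn \<tau> n) + nodal \<tau> \<phi> n x))"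

definition c_skw ::
  "(real^'d) set \<Rightarrow> (real^'d \<Rightarrow> real^'d) \<Rightarrow> (real^'d \<Rightarrow> real^'d) \<Rightarrow> (real^'d \<Rightarrow> real^'d) \<Rightarrow> real" where
  "c_skw \<Omega> vs v w =
    1/2 * l2 \<Omega> (\<lambda>x. weak_jac v x *v vs x) w - 1/2 * l2 \<Omega> (\<lambda>x. weak_jac w x *v vs x) v"

definition E0 :: "(real^'d) set \<Rightarrow> real \<Rightarrow> (real \<Rightarrow> real) \<Rightarrow> (real^'d \<Rightarrow> real) \<Rightarrow> real" where
  "E0 \<Omega> \<gamma> f \<phi> = (LINT x|lebesgue_on \<Omega>. \<gamma> / 2 * (norm (weak_grad \<phi> x))\<^sup>2 + f (\<phi> x))"

definition E1 :: "(real^'d) set \<Rightarrow> real \<Rightarrow> (real \<Rightarrow> real) \<Rightarrow> (real^'d \<Rightarrow> real) \<Rightarrow> (real^'d \<Rightarrow> real^'d) \<Rightarrow> real"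
  where
  "E1 \<Omega> \<gamma> f \<phi> v =
    (LINT x|lebesgue_on \<Omega>. \<gamma> / 2 * (norm (weak_grad \<phi> x))\<^sup>2 + f (\<phi> x) + 1/2 * (norm (v x))\<^sup>2)"

definition CH_scheme where
  "CH_scheme \<Lambda> \<Omega> Th \<tau> N \<gamma> f m \<phi>0 \<phi> \<mu> \<longleftrightarrow>
    \<phi> \<in> Pi1c \<Omega> \<tau> N (Vh \<Lambda> Th) \<and> \<mu> \<in> Pi0 \<Omega> \<tau> N (Vh \<Lambda> Th) \<and>
    (AE x in lebesgue_on \<Omega>. nodal \<tau> \<phi> 0 x = \<phi>0 x) \<and>
    (\<forall>n<N. let \<phi>1 = nodal \<tau> \<phi> (Suc n); \<mu>1 = midval \<tau> \<mu> (Suc n) in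
      (\<forall>\<psi>\<in>Vh \<Lambda> Th.
         l2 \<Omega> (dtau \<tau> (Suc n) \<phi>) \<psi>
         + l2 \<Omega> (\<lambda>x. m (\<phi>1 x) *\<^sub>R weak_grad \<mu>1 x) (weak_grad \<psi>) = 0) \<and>
      (\<forall>\<xi>\<in>Vh \<Lambda> Th.
         l2 \<Omega> \<mu>1 \<xi> - \<gamma> * l2 \<Omega> (weak_grad \<phi>1) (weak_grad \<xi>)
         - l2 \<Omega> (avg_deriv \<tau> f \<phi> n) \<xi> = 0))"

definition CHD_scheme where
  "CHD_scheme \<Lambda> \<Omega> Th \<tau> N \<gamma> f m \<alpha> \<phi>0 \<phi> \<mu> v p \<longleftrightarrow>
    \<phi> \<in> Pi1c \<Omega> \<tau> N (Vh \<Lambda> Th) \<and> \<mu> \<in> Pi0 \<Omega> \<tau> N (Vh \<Lambda> Th) \<and>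
    v \<in> Pi0 \<Omega> \<tau> N (Zh \<Lambda> Th) \<and> p \<in> Pi0 \<Omega> \<tau> N (Wh \<Omega> Th) \<and>
    (AE x in lebesgue_on \<Omega>. nodal \<tau> \<phi> 0 x = \<phi>0 x) \<and>
    (\<forall>n<N. let \<phi>1 = nodal \<tau> \<phi> (Suc n); \<mu>1 = midval \<tau> \<mu> (Suc n);
               v1 = midval \<tau> v (Suc n); p1 = midval \<tau> p (Suc n) in
      (\<forall>\<psi>\<in>Vh \<Lambda> Th.
         l2 \<Omega> (dtau \<tau> (Suc n) \<phi>) \<psi>
         - l2 \<Omega> (\<lambda>x. \<phi>1 x *\<^sub>R v1 x) (weak_grad \<psi>)
         + l2 \<Omega> (\<lambda>x. m (\<phi>1 x) *\<^sub>R weak_grad \<mu>1 x) (weak_grad \<psi>) = 0) \<and>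
      (\<forall>\<xi>\<in>Vh \<Lambda> Th.
         l2 \<Omega> \<mu>1 \<xi> - \<gamma> * l2 \<Omega> (weak_grad \<phi>1) (weak_grad \<xi>)
         - l2 \<Omega> (avg_deriv \<tau> f \<phi> n) \<xi> = 0) \<and>
      (\<forall>w\<in>Zh \<Lambda> Th.
         l2 \<Omega> (\<lambda>x. \<alpha> (\<phi>1 x) *\<^sub>R v1 x) w - l2 \<Omega> p1 (weak_div w)
         + l2 \<Omega> (\<lambda>x. \<phi>1 x *\<^sub>R weak_grad \<mu>1 x) w = 0) \<and>
      (\<forall>q\<in>Wh \<Omega> Th. l2 \<Omega> (weak_div v1) q = 0))"

definition CHNS_scheme where
  "CHNS_scheme \<Lambda> \<Omega> Th \<tau> N \<gamma> f m \<eta> \<phi>0 v0 \<phi> \<mu> v p \<longleftrightarrow>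
    \<phi> \<in> Pi1c \<Omega> \<tau> N (Vh \<Lambda> Th) \<and> v \<in> Pi1c \<Omega> \<tau> N (Xh \<Lambda> Th) \<and>
    \<mu> \<in> Pi0 \<Omega> \<tau> N (Vh \<Lambda> Th) \<and> p \<in> Pi0 \<Omega> \<tau> N (Qh \<Lambda> Th) \<and>
    (AE x in lebesgue_on \<Omega>. nodal \<tau> \<phi> 0 x = \<phi>0 x) \<and>
    (AE x in lebesgue_on \<Omega>. nodal \<tau> v 0 x = v0 x) \<and>
    (\<forall>n<N. let \<phi>1 = nodal \<tau> \<phi> (Suc n); \<mu>1 = midval \<tau> \<mu> (Suc n);
               v1 = nodal \<tau> v (Suc n); p1 = midval \<tau> p (Suc n) in
      (\<forall>\<psi>\<in>Vh \<Lambda> Th.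
         l2 \<Omega> (dtau \<tau> (Suc n) \<phi>) \<psi>
         - l2 \<Omega> (\<lambda>x. \<phi>1 x *\<^sub>R v1 x) (weak_grad \<psi>)
         + l2 \<Omega> (\<lambda>x. m (\<phi>1 x) *\<^sub>R weak_grad \<mu>1 x) (weak_grad \<psi>) = 0) \<and>
      (\<forall>\<xi>\<in>Vh \<Lambda> Th.
         l2 \<Omega> \<mu>1 \<xi> - \<gamma> * l2 \<Omega> (weak_grad \<phi>1) (weak_grad \<xi>)
         - l2 \<Omega> (avg_deriv \<tau> f \<phi> n) \<xi> = 0) \<and>
      (\<forall>w\<in>Xh \<Lambda> Th.
         l2 \<Omega> (dtau \<tau> (Suc n) v) w + c_skw \<Omega> v1 v1 w
         + l2 \<Omega> (\<lambda>x. \<eta> (\<phi>1 x) *\<^sub>R sym_grad v1 x) (sym_grad w)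
         - l2 \<Omega> p1 (weak_div w)
         + l2 \<Omega> (\<lambda>x. \<phi>1 x *\<^sub>R weak_grad \<mu>1 x) w = 0) \<and>
      (\<forall>q\<in>Qh \<Lambda> Th. l2 \<Omega> (weak_div v1) q = 0))"

end

theory Submission
  imports Defs
begin

text \<open>Testing the phase field equation with \<open>1\<close> gives conservation of mass. Testing it with the
  chemical potential, the potential equation with the difference quotient of \<open>\<phi>\<close>, and the momentum
  equation with the velocity cancels all coupling terms. The averaged potential derivative
  reproduces the increment of \<open>f(\<phi>)\<close> exactly, and the implicit quadratic terms dominate the
  increments of their energies by \<open>\<bar>a - b\<bar>\<^sup>2 \<ge> 0\<close>.

  The analytic content is that \<open>weak_grad\<close>, a choice, is linear almost everywhere and vanishes on
  constants. This rests on uniqueness of weak gradients, hence on the existence of enough smooth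
  test functions, and on the fact that the gradient of a test function has integral zero.\<close>

section \<open>Smooth bump functions\<close>

text \<open>An \<open>l2\<close> pairing is a Bochner integral, with value 0 when the integrand is
  not integrable. Hence every splitting of an integral needs an integrability proof. The coupling,
  pressure and convection terms escape this: each cancels against a second occurrence of the very
  same integral. What has to be shown integrable in the energy estimates are the energy densities
  and the products of gradients and velocities that bound their increments.

  Since f is merely C^1, with no growth bound, integrability of f(\<phi>) comes from the
  discretisation: a finite element function is almost everywhere bounded, being polynomial on
  finitely many compact simplices.

  \<open>weak_grad\<close> of a linear combination is an independent choice, so linearity can only
  hold almost everywhere. It is applied to the difference quotient \<open>dtau\<close>, and the case
  of constants to the test function 1.

  \<open>test_function\<close> demands \<open>Ck\<close> for every k, so the bumps are built from
  exp(-1/t). The polynomial factor in \<open>exp_bump\<close> keeps all its derivatives inside one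
  explicit family.\<close>

definition exp_bump :: "real poly \<Rightarrow> real \<Rightarrow> real" where
  "exp_bump p t = (if t \<le> 0 then 0 else poly p (1 / t) * exp (- (1 / t)))"

text \<open>With s = 1/t the limit from the right becomes that of a polynomial in s against exp(s)
  at infinity, where each monomial loses.\<close>

lemma exp_bump_tendsto_0: "(exp_bump p \<longlongrightarrow> 0) (at 0)"
proof -
  have "((\<lambda>s. \<Sum>i\<le>degree p. coeff p i * (s ^ i / exp s)) \<longlongrightarrow> (\<Sum>i\<le>degree p. coeff p i * 0)) at_top"
    by (intro tendsto_intros tendsto_power_div_exp_0)
  then have "((\<lambda>s. poly p s * exp (- s)) \<longlongrightarrow> 0) at_top"
    by (simp add: poly_altdef sum_distrib_right exp_minus divide_inverse mult.assoc)
  from filterlim_compose[OF this filterlim_inverse_at_top_right]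
  have "((\<lambda>t. poly p (1 / t) * exp (- (1 / t))) \<longlongrightarrow> 0) (at_right 0)"
    by (simp add: inverse_eq_divide)
  moreover have "\<forall>\<^sub>F t in at_right 0. poly p (1 / t) * exp (- (1 / t)) = exp_bump p t"
    by (simp add: eventually_at_filter exp_bump_def)
  ultimately have "(exp_bump p \<longlongrightarrow> 0) (at_right 0)"
    by (rule Lim_transform_eventually)
  moreover have "(exp_bump p \<longlongrightarrow> 0) (at_left 0)"
    by (rule tendsto_eventually) (simp add: eventually_at_filter exp_bump_def)
  ultimately show ?thesis
    by (simp add: filterlim_split_at)
qed

text \<open>With s = 1/t one has d/dt = -s^2 d/ds, and p(s) exp(-s) turns into s^2 (p - p')(s)
  exp(-s). So the family is closed under differentiation, and smoothness follows by induction with p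
  left arbitrary.\<close>

lemma exp_bump_has_derivative:
  "(exp_bump p has_real_derivative exp_bump ([:0, 0, 1:] * (p - pderiv p)) t) (at t)"
proof -
  consider "t < 0" | "t = 0" | "t > 0" by linarith
  then show ?thesis
  proof cases
    case 1
    have "(exp_bump p has_real_derivative 0) (at t)"
      by (rule has_field_derivative_transform_within_open[where f="\<lambda>_. 0" and S="{..<0}"])
        (use 1 in \<open>auto simp: exp_bump_def\<close>)
    then show ?thesis using 1 by (simp add: exp_bump_def)
  next
    case 2
    \<comment> \<open>Dividing by h is multiplying by 1/h, the polynomial variable, so the
      difference quotient at 0 is again in the family and tends to 0.\<close>
    have "exp_bump p h / h = exp_bump (pCons 0 p) h" for h
      by (simp add: exp_bump_def)
    then show ?thesis
      using exp_bump_tendsto_0[of "pCons 0 p"] 2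
      by (simp add: DERIV_def exp_bump_def[of _ 0])
  next
    case 3
    have "((\<lambda>t. poly p (1 / t) * exp (- (1 / t))) has_real_derivative
        exp_bump ([:0, 0, 1:] * (p - pderiv p)) t) (at t)"
      using 3 by (auto intro!: derivative_eq_intros poly_DERIV[THEN DERIV_chain2]
          simp: exp_bump_def divide_simps algebra_simps)
    then show ?thesis
      by (rule has_field_derivative_transform_within_open[where S="{0<..}"])
        (use 3 in \<open>auto simp: exp_bump_def\<close>)
  qed
qed

section \<open>Calculus of \<open>Ck\<close> functions\<close>

lemma gradient_eq: "(\<psi> has_derivative D) (at x) \<Longrightarrow> gradient \<psi> x $ i = D (axis i 1)"
  unfolding gradient_def by (simp add: frechet_derivative_at[symmetric])

text \<open>\<open>Ck\<close> recurses through \<open>gradient\<close>, hence through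
  \<open>frechet_derivative\<close>; this rule lets a proof supply an explicit derivative
  instead.\<close>

lemma Ck_SucI:
  assumes "\<And>x. (\<psi> has_derivative D x) (at x)" and "\<And>i. Ck k (\<lambda>x. D x (axis i 1))"
  shows "Ck (Suc k) \<psi>"
proof -
  have "gradient \<psi> x $ i = D x (axis i 1)" for x i
    using assms(1) by (rule gradient_eq)
  then show ?thesis using assms by (auto simp: differentiable_def)
qed

lemma Ck_const: "Ck k (\<lambda>x. c)"
proof (induction k arbitrary: c)
  case (Suc k)
  show ?case by (rule Ck_SucI[where D="\<lambda>x h. 0"]) (auto intro: Suc)
qed auto

text \<open>For the product rule: u' v + u v' also contains the undifferentiated factors, which are
  then needed one order lower.\<close>

lemma Ck_SucD:
  assumes "Ck (Suc k) \<psi>"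
  shows "Ck k \<psi>"
  using assms
proof (induction k arbitrary: \<psi>)
  case 0
  then show ?case
    by (auto simp: continuous_on_eq_continuous_at differentiable_imp_continuous_within)
qed auto

lemma Ck_imp_continuous: "Ck k \<psi> \<Longrightarrow> continuous_on UNIV \<psi>"
  by (cases k) (auto simp: continuous_on_eq_continuous_at differentiable_imp_continuous_within)

lemma Ck_Suc_has_derivative:
  assumes "Ck (Suc k) \<psi>"
  shows "(\<psi> has_derivative frechet_derivative \<psi> (at x)) (at x)"
    and "Ck k (\<lambda>x. frechet_derivative \<psi> (at x) (axis i 1))"
  using assms by (auto simp: frechet_derivative_works gradient_def)

lemma Ck_add:
  assumes "Ck k u" "Ck k v"
  shows "Ck k (\<lambda>x. u x + v x)"
  using assms
proof (induction k arbitrary: u v)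
  case (Suc k)
  show ?case
    by (rule Ck_SucI[OF has_derivative_add[OF Ck_Suc_has_derivative(1)[OF Suc.prems(1)]
          Ck_Suc_has_derivative(1)[OF Suc.prems(2)]]])
      (intro Suc.IH Ck_Suc_has_derivative(2) Suc.prems)
qed (auto intro: continuous_intros)

lemma Ck_mult:
  assumes "Ck k u" "Ck k v"
  shows "Ck k (\<lambda>x. u x * v x)"
  using assms
proof (induction k arbitrary: u v)
  case (Suc k)
  show ?case
    by (rule Ck_SucI[OF has_derivative_mult[OF Ck_Suc_has_derivative(1)[OF Suc.prems(1)]
          Ck_Suc_has_derivative(1)[OF Suc.prems(2)]]])
      (intro Ck_add Suc.IH Ck_Suc_has_derivative(2) Suc.prems Ck_SucD[OF Suc.prems(1)]
        Ck_SucD[OF Suc.prems(2)])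
qed (auto intro: continuous_intros)

lemma Ck_prod:
  assumes "finite J" "\<And>j. j \<in> J \<Longrightarrow> Ck k (u j)"
  shows "Ck k (\<lambda>x. \<Prod>j\<in>J. u j x)"
  using assms by (induction J rule: finite_induct) (auto intro: Ck_const Ck_mult)

text \<open>The affine argument c + s x_i covers both factors of a box bump, with s positive for the
  lower face and negative for the upper one. Each derivative only changes p and contributes a
  constant factor.\<close>

lemma Ck_exp_bump: "Ck k (\<lambda>x. exp_bump p (c + s * x $ i))"
proof (induction k arbitrary: p)
  case 0
  have "continuous_on UNIV (exp_bump p)"
    using exp_bump_has_derivative DERIV_isCont by (force simp: continuous_on_eq_continuous_at)
  then show ?case
    by (auto intro!: continuous_intros continuous_on_compose2[of UNIV "exp_bump p"])
next
  case (Suc k)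
  let ?q = "[:0, 0, 1:] * (p - pderiv p)"
  have "((\<lambda>x. exp_bump p (c + s * x $ i)) has_derivative
      (\<lambda>h. (s * h $ i) * exp_bump ?q (c + s * x $ i))) (at x)" for x :: "real^'a"
  proof -
    have "((\<lambda>x. c + s * x $ i) has_derivative (\<lambda>h. s * h $ i)) (at x)"
      by (auto intro!: derivative_eq_intros bounded_linear_vec_nth bounded_linear_imp_has_derivative)
    from has_derivative_compose[OF this exp_bump_has_derivative[THEN has_field_derivative_imp_has_derivative]]
    show ?thesis by (simp add: mult.commute)
  qed
  then show ?case
    by (rule Ck_SucI) (intro Ck_mult Ck_const Suc)
qed

text \<open>Each coordinate gets one factor per face, so the bump is positive exactly on the open
  box. Stretching the arguments by \<open>Suc n\<close> drives the factors to 1 inside;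
  \<open>Suc n\<close> rather than n keeps the stretching positive for every index.\<close>

definition box_bump :: "real^'d \<Rightarrow> real^'d \<Rightarrow> nat \<Rightarrow> real^'d \<Rightarrow> real" where
  "box_bump a b n x = (\<Prod>i\<in>UNIV. exp_bump 1 (Suc n * (x $ i - a $ i)) * exp_bump 1 (Suc n * (b $ i - x $ i)))"

lemma box_bump_eq_0_iff: "box_bump a b n x = 0 \<longleftrightarrow> x \<notin> box a b"
  unfolding box_bump_def mem_box_cart exp_bump_def
  by (auto simp: not_less zero_less_mult_iff mult_le_0_iff)

lemma test_function_box_bump: "test_function (box_bump a b n)"
proof -
  \<comment> \<open>Both arguments are rewritten as affine functions of the coordinate, the shape of
    \<open>Ck_exp_bump\<close>.\<close>
  have "box_bump a b n = (\<lambda>x. \<Prod>i\<in>UNIV. exp_bump 1 (- Suc n * a $ i + Suc n * x $ i)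
      * exp_bump 1 (Suc n * b $ i + (- Suc n) * x $ i))"
    by (auto simp: box_bump_def algebra_simps fun_eq_iff)
  then have "Ck k (box_bump a b n)" for k
    by (simp only:) (intro Ck_prod Ck_mult Ck_exp_bump, simp)
  moreover have "closure {x. box_bump a b n x \<noteq> 0} \<subseteq> cbox a b"
    by (rule closure_minimal) (auto simp: box_bump_eq_0_iff intro: box_subset_cbox[THEN subsetD])
  ultimately show ?thesis
    unfolding test_function_def
    by (metis bounded_cbox bounded_subset closed_closure compact_eq_bounded_closed)
qed

lemma exp_bump_1_bounds: "0 \<le> exp_bump 1 t" "exp_bump 1 t \<le> 1"
  by (auto simp: exp_bump_def)

lemma box_bump_bounds: "0 \<le> box_bump a b n x" "box_bump a b n x \<le> 1"
  unfolding box_bump_def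
  by (auto intro!: prod_nonneg prod_le_1 mult_nonneg_nonneg mult_le_one exp_bump_1_bounds)

lemma exp_bump_1_limit:
  fixes t :: real
  assumes t: "t > 0"
  shows "(\<lambda>n. exp_bump 1 (Suc n * t)) \<longlonglongrightarrow> 1"
proof -
  have "(\<lambda>n. exp (- ((1 / real (Suc n)) * (1 / t)))) \<longlonglongrightarrow> exp (- (0 * (1 / t)))"
    by (intro tendsto_intros LIMSEQ_inverse_real_of_nat[unfolded inverse_eq_divide])
  moreover have "exp_bump 1 (Suc n * t) = exp (- ((1 / real (Suc n)) * (1 / t)))" for n
    using t by (simp add: exp_bump_def mult_le_0_iff del: of_nat_Suc)
  ultimately show ?thesis
    by simp
qed

lemma box_bump_limit: "(\<lambda>n. box_bump a b n x) \<longlonglongrightarrow> indicator (box a b) x"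
proof (cases "x \<in> box a b")
  case True
  have "(\<lambda>n. box_bump a b n x) \<longlonglongrightarrow> (\<Prod>i\<in>(UNIV::'a set). 1 * 1)"
    unfolding box_bump_def using True by (intro tendsto_intros exp_bump_1_limit) (simp_all add: mem_box_cart)
  then show ?thesis using True by simp
next
  case False
  then have "box_bump a b n x = 0" for n by (simp add: box_bump_eq_0_iff)
  then show ?thesis using False by simp
qed

section \<open>Square integrable functions\<close>

lemma square_integrable_subset:
  assumes "square_integrable S u" "T \<subseteq> S" "S \<in> sets lebesgue" "T \<in> sets lebesgue"
  shows "square_integrable T u"
proof -
  have "integrable lebesgue (\<lambda>x. indicator S x *\<^sub>R (norm (u x))\<^sup>2)"
    using assms by (auto simp: square_integrable_def integrable_restrict_space)
  with assms(4) have "integrable lebesgue (\<lambda>x. indicator T x *\<^sub>R (indicator S x *\<^sub>R (norm (u x))\<^sup>2))"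
    by (rule integrable_mult_indicator)
  also have "(\<lambda>x. indicator T x *\<^sub>R (indicator S x *\<^sub>R (norm (u x))\<^sup>2)) = (\<lambda>x. indicator T x *\<^sub>R (norm (u x))\<^sup>2)"
    using assms(2) by (auto simp: indicator_def fun_eq_iff)
  finally have "integrable (lebesgue_on T) (\<lambda>x. (norm (u x))\<^sup>2)"
    using assms(4) by (subst integrable_restrict_space) auto
  moreover have "u \<in> borel_measurable (lebesgue_on T)"
    by (rule measurable_restrict_mono[OF _ assms(2)]) (use assms(1) in \<open>simp add: square_integrable_def\<close>)
  ultimately show ?thesis by (simp add: square_integrable_def)
qed

lemma square_integrable_const:
  assumes "S \<in> lmeasurable"
  shows "square_integrable S (\<lambda>x. c)"
  using finite_measure.integrable_const[OF finite_measure_lebesgue_on[OF assms]]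
  by (simp add: square_integrable_def)

lemma square_integrable_scaleR:
  assumes "square_integrable S u"
  shows "square_integrable S (\<lambda>x. c *\<^sub>R u x)"
proof -
  have [measurable]: "u \<in> borel_measurable (lebesgue_on S)"
    using assms by (auto simp: square_integrable_def)
  show ?thesis using assms by (simp add: square_integrable_def power_mult_distrib)
qed

lemma square_integrable_add:
  assumes "square_integrable S u" "square_integrable S w"
  shows "square_integrable S (\<lambda>x. u x + w x)"
proof -
  have [measurable]: "u \<in> borel_measurable (lebesgue_on S)" "w \<in> borel_measurable (lebesgue_on S)"
    using assms by (auto simp: square_integrable_def)
  have "(norm (a + b))\<^sup>2 \<le> 2 * (norm a)\<^sup>2 + 2 * (norm b)\<^sup>2" for a b :: 'b
  proof -
    have "(norm (a + b))\<^sup>2 \<le> (norm a + norm b)\<^sup>2"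
      by (intro power_mono norm_triangle_ineq) auto
    also have "\<dots> \<le> 2 * (norm a)\<^sup>2 + 2 * (norm b)\<^sup>2"
      using zero_le_power2[of "norm a - norm b"] by (simp add: power2_sum power2_diff)
    finally show ?thesis .
  qed
  then have "AE x in lebesgue_on S. norm ((norm (u x + w x))\<^sup>2) \<le> norm (2 * (norm (u x))\<^sup>2 + 2 * (norm (w x))\<^sup>2)"
    by (intro AE_I2) simp
  moreover have "integrable (lebesgue_on S) (\<lambda>x. 2 * (norm (u x))\<^sup>2 + 2 * (norm (w x))\<^sup>2)"
    using assms by (simp add: square_integrable_def)
  ultimately have "integrable (lebesgue_on S) (\<lambda>x. (norm (u x + w x))\<^sup>2)"
    by (rule Bochner_Integration.integrable_bound[rotated 2]) measurable
  then show ?thesis by (simp add: square_integrable_def)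
qed

lemma square_integrable_imp_integrable_inner:
  assumes "square_integrable S u" "square_integrable S w"
  shows "integrable (lebesgue_on S) (\<lambda>x. u x \<bullet> w x)"
proof -
  have [measurable]: "u \<in> borel_measurable (lebesgue_on S)" "w \<in> borel_measurable (lebesgue_on S)"
    using assms by (auto simp: square_integrable_def)
  have "\<bar>a \<bullet> b\<bar> \<le> (norm a)\<^sup>2 + (norm b)\<^sup>2" for a b :: 'b
    using Cauchy_Schwarz_ineq2[of a b] zero_le_power2[of "norm a - norm b"]
      zero_le_power2[of "norm a"] zero_le_power2[of "norm b"]
    unfolding power2_diff by linarith
  then have "AE x in lebesgue_on S. norm (u x \<bullet> w x) \<le> norm ((norm (u x))\<^sup>2 + (norm (w x))\<^sup>2)"
    by (intro AE_I2) simp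
  moreover have "integrable (lebesgue_on S) (\<lambda>x. (norm (u x))\<^sup>2 + (norm (w x))\<^sup>2)"
    using assms by (simp add: square_integrable_def)
  ultimately show ?thesis
    by (rule Bochner_Integration.integrable_bound[rotated 2]) measurable
qed

lemma square_integrable_imp_integrable:
  assumes "square_integrable S u" "S \<in> lmeasurable"
  shows "integrable (lebesgue_on S) u"
proof (rule Bochner_Integration.integrable_bound)
  have "integrable (lebesgue_on S) (\<lambda>x. (norm (u x))\<^sup>2)"
    using assms(1) by (simp add: square_integrable_def)
  moreover have "integrable (lebesgue_on S) (\<lambda>x. 1 :: real)"
    by (rule finite_measure.integrable_const[OF finite_measure_lebesgue_on[OF assms(2)]])
  ultimately show "integrable (lebesgue_on S) (\<lambda>x. (norm (u x))\<^sup>2 + 1)"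
    by (rule Bochner_Integration.integrable_add)
  have "a \<le> a\<^sup>2 + 1" if "a \<ge> 0" for a :: real
    using zero_le_power2[of "a - 1"] that by (simp add: power2_eq_square algebra_simps)
  then show "AE x in lebesgue_on S. norm (u x) \<le> norm ((norm (u x))\<^sup>2 + 1)"
    by (intro AE_I2) simp
  show "u \<in> borel_measurable (lebesgue_on S)"
    using assms(1) by (simp add: square_integrable_def)
qed

section \<open>Locally square integrable functions and compactly supported factors\<close>

lemma l2_loc_add: "l2_loc u \<Longrightarrow> l2_loc w \<Longrightarrow> l2_loc (\<lambda>x. u x + w x)"
  unfolding l2_loc_def by (blast intro: square_integrable_add)

lemma l2_loc_scaleR: "l2_loc u \<Longrightarrow> l2_loc (\<lambda>x. c *\<^sub>R u x)"
  unfolding l2_loc_def by (blast intro: square_integrable_scaleR)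

lemma l2_loc_const: "l2_loc (\<lambda>x. c)"
  unfolding l2_loc_def by (blast intro: square_integrable_const lmeasurable_compact)

lemma l2_loc_imp_square_integrable:
  assumes "l2_loc u" "bounded S" "S \<in> sets lebesgue"
  shows "square_integrable S u"
proof -
  have "compact (closure S)" using assms by (simp add: compact_closure)
  then have "square_integrable (closure S) u" using assms(1) unfolding l2_loc_def by blast
  then show ?thesis
    by (rule square_integrable_subset) (simp_all add: closure_subset assms(3))
qed

text \<open>\<open>l2_loc\<close> speaks about compact sets, whereas the weak derivative identities
  integrate over the whole space. Vanishing outside S bridges the two, and on S, which has finite
  measure, square integrability of h gives integrability.\<close>

lemma integrable_lebesgue_compact_support:
  assumes h: "l2_loc h" and S: "compact S"
    and F: "F \<in> borel_measurable (lebesgue_on S)" "\<And>x. x \<in> S \<Longrightarrow> norm (F x) \<le> C * norm (h x)"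
      "\<And>x. x \<notin> S \<Longrightarrow> F x = 0"
  shows "integrable lebesgue (F :: real^'d \<Rightarrow> 'b::euclidean_space)"
proof -
  have "integrable (lebesgue_on S) (\<lambda>x. C * norm (h x))"
    using h S by (intro integrable_mult_right integrable_norm square_integrable_imp_integrable)
      (auto simp: l2_loc_def lmeasurable_compact)
  then have "integrable (lebesgue_on S) F"
  proof (rule Bochner_Integration.integrable_bound)
    show "AE x in lebesgue_on S. norm (F x) \<le> norm (C * norm (h x))"
    proof (rule AE_I2)
      fix x assume "x \<in> space (lebesgue_on S)"
      then have "norm (F x) \<le> C * norm (h x)" using F(2) by simp
      also have "\<dots> \<le> norm (C * norm (h x))" by simp
      finally show "norm (F x) \<le> norm (C * norm (h x))" .
    qed
  qed (rule F(1))
  moreover have "indicator S x *\<^sub>R F x = F x" for x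
    using F(3) by (cases "x \<in> S") auto
  ultimately show ?thesis
    using S by (simp add: integrable_restrict_space borel_closed compact_imp_closed)
qed

lemma continuous_compact_bound:
  assumes "continuous_on UNIV (w :: real^'d \<Rightarrow> 'b::real_normed_vector)" "compact S"
  obtains B where "B \<ge> 0" "\<And>x. x \<in> S \<Longrightarrow> norm (w x) \<le> B"
proof -
  have "bounded (w ` S)"
    using assms by (meson compact_continuous_image compact_imp_bounded continuous_on_subset subset_UNIV)
  then obtain B where "B > 0" "\<forall>y\<in>w ` S. norm y \<le> B"
    unfolding bounded_pos by blast
  then show ?thesis by (intro that[of B]) auto
qed

text \<open>Two mirrored versions are needed because the scalar stands on the left: here it is the
  locally integrable factor, as in u times \<open>gradient \<psi>\<close>; in the next lemma it is
  the continuous one, as in \<psi> times a weak gradient.\<close>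

lemma integrable_l2_loc_scaleR_continuous:
  assumes h: "l2_loc h" and S: "compact S" and w: "continuous_on UNIV w" "\<And>x. x \<notin> S \<Longrightarrow> w x = 0"
  shows "integrable lebesgue (\<lambda>x. h x *\<^sub>R w x :: 'b::euclidean_space)"
proof -
  obtain B where B: "B \<ge> 0" "\<And>x. x \<in> S \<Longrightarrow> norm (w x) \<le> B"
    using continuous_compact_bound[OF w(1) S] by blast
  have [measurable]: "h \<in> borel_measurable (lebesgue_on S)"
    using h S unfolding l2_loc_def square_integrable_def by blast
  have [measurable]: "w \<in> borel_measurable (lebesgue_on S)"
    by (rule continuous_imp_measurable_on_sets_lebesgue[OF continuous_on_subset[OF w(1) subset_UNIV]])
      (simp add: S compact_imp_closed)
  have "norm (h x *\<^sub>R w x) \<le> B * norm (h x)" if "x \<in> S" for x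
    using mult_right_mono[OF B(2)[OF that] norm_ge_zero[of "h x"]] by (simp add: mult.commute)
  then show ?thesis
    by (intro integrable_lebesgue_compact_support[OF h S, of _ B]) (simp_all add: w(2))
qed

lemma integrable_continuous_scaleR_l2_loc:
  assumes h: "l2_loc h" and S: "compact S" and w: "continuous_on UNIV w" "\<And>x. x \<notin> S \<Longrightarrow> w x = 0"
  shows "integrable lebesgue (\<lambda>x. w x *\<^sub>R h x :: 'b::euclidean_space)"
proof -
  obtain B where B: "B \<ge> 0" "\<And>x. x \<in> S \<Longrightarrow> norm (w x) \<le> B"
    using continuous_compact_bound[OF w(1) S] by blast
  have [measurable]: "h \<in> borel_measurable (lebesgue_on S)"
    using h S unfolding l2_loc_def square_integrable_def by blast
  have [measurable]: "w \<in> borel_measurable (lebesgue_on S)"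
    by (rule continuous_imp_measurable_on_sets_lebesgue[OF continuous_on_subset[OF w(1) subset_UNIV]])
      (simp add: S compact_imp_closed)
  have "norm (w x *\<^sub>R h x) \<le> B * norm (h x)" if "x \<in> S" for x
    using mult_right_mono[OF B(2)[OF that] norm_ge_zero[of "h x"]] by simp
  then show ?thesis
    by (intro integrable_lebesgue_compact_support[OF h S, of _ B]) (simp_all add: w(2))
qed

section \<open>Test functions and weak gradients\<close>

lemma linear_axis_expansion:
  assumes "linear (D :: real^'d \<Rightarrow> real)"
  shows "D h = (\<chi> i. D (axis i 1)) \<bullet> h"
proof -
  have "D h = D (\<Sum>i\<in>UNIV. h $ i *\<^sub>R axis i 1)"
    using basis_expansion[of h] by (simp add: scalar_mult_eq_scaleR)
  also have "\<dots> = (\<Sum>i\<in>UNIV. h $ i * D (axis i 1))"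
    using assms by (simp add: linear_sum linear_scale)
  finally show ?thesis
    by (simp add: inner_vec_def mult.commute)
qed

lemma test_function_continuous: "test_function \<psi> \<Longrightarrow> continuous_on UNIV \<psi>"
  unfolding test_function_def by (meson Ck_imp_continuous)

lemma test_function_has_derivative:
  assumes "test_function \<psi>"
  shows "(\<psi> has_derivative (\<lambda>h. gradient \<psi> x \<bullet> h)) (at x)"
proof -
  have "Ck (Suc 0) \<psi>" using assms unfolding test_function_def by blast
  then have D: "(\<psi> has_derivative frechet_derivative \<psi> (at x)) (at x)"
    by (rule Ck_Suc_has_derivative)
  have "frechet_derivative \<psi> (at x) = (\<lambda>h. gradient \<psi> x \<bullet> h)"
    unfolding gradient_def by (intro ext linear_axis_expansion[OF has_derivative_linear[OF D]])
  with D show ?thesis by simp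
qed

lemma test_function_continuous_gradient:
  assumes "test_function \<psi>"
  shows "continuous_on UNIV (gradient \<psi>)"
proof -
  have "Ck (Suc 0) \<psi>" using assms unfolding test_function_def by blast
  then have "continuous_on UNIV (\<lambda>x. \<chi> i. gradient \<psi> x $ i)"
    by (intro continuous_on_vec_lambda) simp
  then show ?thesis by simp
qed

text \<open>S is the closed support, so its complement is open; around a point outside S the
  function is identically 0 and so is its derivative.\<close>

lemma test_function_support:
  assumes "test_function \<psi>"
  obtains S where "compact S" "\<And>x. x \<notin> S \<Longrightarrow> \<psi> x = 0" "\<And>x. x \<notin> S \<Longrightarrow> gradient \<psi> x = 0"
proof -
  define S where "S = closure {x. \<psi> x \<noteq> 0}"
  have 0: "\<psi> x = 0" if "x \<notin> S" for x
    using that closure_subset[of "{x. \<psi> x \<noteq> 0}"] unfolding S_def by blast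
  have "gradient \<psi> x = 0" if x: "x \<notin> S" for x
  proof -
    have "(\<psi> has_derivative (\<lambda>h. 0)) (at x)"
    proof (rule has_derivative_transform_within_open[of "\<lambda>_. 0"])
      show "open (- S)" by (simp add: S_def open_Compl)
    qed (use x 0 in \<open>simp_all\<close>)
    from gradient_eq[OF this] show ?thesis by (simp add: vec_eq_iff)
  qed
  moreover have "compact S"
    using assms by (simp add: S_def test_function_def)
  ultimately show ?thesis
    using 0 that by blast
qed

text \<open>Testing with bumps that increase to the indicator of a box shows that all integrals over
  boxes vanish.\<close>

lemma fundamental_lemma_of_variations:
  fixes h :: "real^'d \<Rightarrow> 'b::euclidean_space"
  assumes h: "l2_loc h"
    and zero: "\<And>\<psi>. test_function \<psi> \<Longrightarrow> (LINT x|lebesgue. \<psi> x *\<^sub>R h x) = 0"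
  shows "AE x in lebesgue. h x = 0"
proof -
  have int_cbox: "integrable lebesgue (\<lambda>x. indicator (cbox a b) x *\<^sub>R h x)" for a b
    using square_integrable_imp_integrable[of "cbox a b" h] h
    by (simp add: l2_loc_def integrable_restrict_space)
  have box0: "(LINT x|lebesgue. indicator (box a b) x *\<^sub>R h x) = 0" for a b
  proof -
    have int_n: "integrable lebesgue (\<lambda>x. box_bump a b n x *\<^sub>R h x)" for n
      by (rule integrable_continuous_scaleR_l2_loc[OF h compact_cbox[of a b]
            test_function_continuous[OF test_function_box_bump]])
        (use box_bump_eq_0_iff box_subset_cbox in blast)
    have "integrable lebesgue (\<lambda>x. indicator (box a b) x *\<^sub>R (indicator (cbox a b) x *\<^sub>R h x))"
      by (intro integrable_mult_indicator int_cbox) auto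
    also have "(\<lambda>x. indicator (box a b) x *\<^sub>R (indicator (cbox a b) x *\<^sub>R h x))
        = (\<lambda>x. indicator (box a b) x *\<^sub>R h x)"
      using box_subset_cbox[of a b] by (auto simp: indicator_def fun_eq_iff)
    finally have int_box: "integrable lebesgue (\<lambda>x. indicator (box a b) x *\<^sub>R h x)" .
    have bound: "norm (box_bump a b n x *\<^sub>R h x) \<le> norm (indicator (cbox a b) x *\<^sub>R h x)" for n x
    proof (cases "x \<in> box a b")
      case True
      then have "x \<in> cbox a b" using box_subset_cbox by blast
      then show ?thesis
        using box_bump_bounds[of a b n x] by (simp add: mult_left_le_one_le)
    next
      case False
      then have "box_bump a b n x = 0" by (simp add: box_bump_eq_0_iff)
      then show ?thesis by simp
    qed
    have "(\<lambda>n. LINT x|lebesgue. box_bump a b n x *\<^sub>R h x)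
        \<longlonglongrightarrow> (LINT x|lebesgue. indicator (box a b) x *\<^sub>R h x)"
    proof (rule integral_dominated_convergence)
      show "integrable lebesgue (\<lambda>x. norm (indicator (cbox a b) x *\<^sub>R h x))"
        by (intro integrable_norm int_cbox)
      show "AE x in lebesgue. (\<lambda>n. box_bump a b n x *\<^sub>R h x) \<longlonglongrightarrow> indicator (box a b) x *\<^sub>R h x"
        by (intro AE_I2 tendsto_scaleR box_bump_limit tendsto_const)
    qed (use int_box int_n bound in \<open>auto intro: borel_measurable_integrable\<close>)
    moreover have "(LINT x|lebesgue. box_bump a b n x *\<^sub>R h x) = 0" for n
      by (intro zero test_function_box_bump)
    ultimately show ?thesis
      by (simp add: LIMSEQ_const_iff)
  qed
  \<comment> \<open>h is integrable only on bounded sets, so it is shown to vanish on one box at a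
    time. Cutting it off there gives H, integrable over the whole space.\<close>
  have local: "AE x in lebesgue. x \<in> box a b \<longrightarrow> h x = 0" for a b
  proof -
    define H where "H = (\<lambda>x. indicator (box a b) x *\<^sub>R h x)"
    have fin: "finite_measure (lebesgue_on (box a b))"
      by (rule finite_measure_lebesgue_on) simp
    have "square_integrable (box a b) h"
      using h by (intro l2_loc_imp_square_integrable) auto
    then have int_h: "integrable (lebesgue_on (box a b)) h"
      by (rule square_integrable_imp_integrable) simp
    then have int_H: "integrable lebesgue H"
      by (simp add: H_def integrable_restrict_space)
    \<comment> \<open>Dynkin's argument: boxes are stable under intersection and generate the Borel
      sets, and the sets over which the integrable H has integral zero are closed under complements
      and countable disjoint unions.\<close>
    have borel0: "(LINT x:A|lebesgue. H x) = 0" if "A \<in> sets borel" for A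
    proof -
      let ?E = "range (\<lambda>(a, b). box a b :: (real^'d) set)"
      have sets_eq: "sigma_sets UNIV ?E = sets borel"
        by (simp add: borel_eq_box)
      then have A: "A \<in> sigma_sets UNIV ?E"
        using that by simp
      have meas: "sigma_sets UNIV ?E \<subseteq> sets lebesgue"
        unfolding sets_eq by auto
      show ?thesis
      proof (rule sigma_sets_induct_disjoint[OF _ _ A])
        show "Int_stable ?E"
          by (auto simp: Int_stable_def box_Int_box)
        show "(LINT x:B|lebesgue. H x) = 0" if B: "B \<in> ?E" for B
        proof -
          obtain c d where B: "B = box c d" using B by auto
          \<comment> \<open>The corners of the intersection of the two boxes; it is again a box, so
            \<open>box0\<close> applies to it.\<close>
          define c' where "c' = (\<Sum>i\<in>Basis. max (c \<bullet> i) (a \<bullet> i) *\<^sub>R i)"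
          define d' where "d' = (\<Sum>i\<in>Basis. min (d \<bullet> i) (b \<bullet> i) *\<^sub>R i)"
          have "box c d \<inter> box a b = box c' d'"
            unfolding c'_def d'_def by (rule box_Int_box)
          then have "indicator B x *\<^sub>R H x = indicator (box c' d') x *\<^sub>R h x" for x
            by (auto simp: B H_def indicator_def)
          then show ?thesis
            unfolding set_lebesgue_integral_def by (simp add: box0)
        qed
        show "(LINT x:UNIV - B|lebesgue. H x) = 0"
          if "B \<in> sigma_sets UNIV ?E" and 0: "(LINT x:B|lebesgue. H x) = 0" for B
        proof -
          have "set_integrable lebesgue B H" "set_integrable lebesgue (UNIV - B) H"
            using that meas int_H by (auto simp: set_integrable_def intro!: integrable_mult_indicator)
          then have "(LINT x:B \<union> (UNIV - B)|lebesgue. H x) = (LINT x:B|lebesgue. H x) + (LINT x:UNIV - B|lebesgue. H x)"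
            by (intro set_integral_Un) auto
          \<comment> \<open>Since H lives on \<open>box a b\<close>, its integral over the whole
            space is the one that \<open>box0\<close> makes zero. This settles complements.\<close>
          moreover have "(LINT x:B \<union> (UNIV - B)|lebesgue. H x) = 0"
            using box0[of a b] by (simp add: set_lebesgue_integral_def H_def)
          ultimately show ?thesis using 0 by simp
        qed
        show "(LINT x:(\<Union>i. B i)|lebesgue. H x) = 0"
          if B: "disjoint_family B" "range B \<subseteq> sigma_sets UNIV ?E"
            and 0: "\<And>i. (LINT x:B i|lebesgue. H x) = 0" for B :: "nat \<Rightarrow> (real^'d) set"
        proof -
          have "(LINT x:(\<Union>i. B i)|lebesgue. H x) = (\<Sum>i. (LINT x:B i|lebesgue. H x))"
          proof (rule lebesgue_integral_countable_add)
            show "B i \<in> sets lebesgue" for i using B(2) meas by blast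
            then show "set_integrable lebesgue (\<Union>i. B i) H"
              using int_H by (auto simp: set_integrable_def intro!: integrable_mult_indicator)
          qed (use B(1) in \<open>auto simp: disjoint_family_on_def\<close>)
          then show ?thesis using 0 by simp
        qed
      qed (auto simp: set_lebesgue_integral_def)
    qed
    have "AE x in lebesgue_on (box a b). h x = 0"
    proof (rule sigma_finite_measure.density_zero[OF finite_measure.axioms(1)[OF fin] int_h])
      fix A assume "A \<in> sets (lebesgue_on (box a b))"
      then have A: "A \<in> sets lebesgue" "A \<subseteq> box a b"
        by (auto simp: sets_restrict_space)
      have "(LINT x:A|lebesgue_on (box a b). h x) = (LINT x:A|lebesgue. H x)"
        unfolding set_lebesgue_integral_def H_def
        by (subst integral_restrict_space) (auto simp: ac_simps)
      \<comment> \<open>\<open>density_zero\<close> asks for every Lebesgue set A, while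
        \<open>borel0\<close> treats Borel sets. A differs from its Borel part
        \<open>main_part lborel A\<close> by a null set only.\<close>
      also have "\<dots> = (LINT x:main_part lborel A|lebesgue. H x)"
        unfolding set_lebesgue_integral_def
      proof (rule integral_cong_AE)
        have "AE x in lebesgue. x \<notin> null_part lborel A"
          using AE_notin_null_part[OF A(1)] by (rule AE_completion)
        then show "AE x in lebesgue. indicat_real A x *\<^sub>R H x = indicat_real (main_part lborel A) x *\<^sub>R H x"
          by eventually_elim (use main_part_null_part_Un[OF A(1)] in \<open>auto simp: indicator_def\<close>)
      qed (use int_H A in \<open>auto intro!: borel_measurable_integrable integrable_mult_indicator\<close>)
      also have "\<dots> = 0"
        using main_part_sets[OF A(1)] by (intro borel0) simp
      finally show "(LINT x:A|lebesgue_on (box a b). h x) = 0" .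
    qed
    then show ?thesis by (simp add: AE_restrict_space_iff)
  qed
  \<comment> \<open>Countably many boxes exhaust the space, so the exceptional null sets can be
    united.\<close>
  have "AE x in lebesgue. \<forall>n::nat. x \<in> box (- (real n *\<^sub>R One)) (real n *\<^sub>R One) \<longrightarrow> h x = 0"
    unfolding AE_all_countable using local by blast
  then show ?thesis
    by eventually_elim (use UN_box_eq_UNIV in blast)
qed

section \<open>Uniqueness and linearity of weak gradients; weak gradients of constants\<close>

lemma test_function_integrable:
  assumes \<psi>: "test_function \<psi>"
  shows "l2_loc h \<Longrightarrow> integrable lebesgue (\<lambda>x. \<psi> x *\<^sub>R h x :: 'b::euclidean_space)"
    and "l2_loc u \<Longrightarrow> integrable lebesgue (\<lambda>x. u x *\<^sub>R gradient \<psi> x)"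
proof -
  obtain S where S: "compact S" "\<And>x. x \<notin> S \<Longrightarrow> \<psi> x = 0" "\<And>x. x \<notin> S \<Longrightarrow> gradient \<psi> x = 0"
    using test_function_support[OF \<psi>] by blast
  show "integrable lebesgue (\<lambda>x. \<psi> x *\<^sub>R h x)" if "l2_loc h"
    using S(2) by (rule integrable_continuous_scaleR_l2_loc[OF that S(1) test_function_continuous[OF \<psi>]])
  show "integrable lebesgue (\<lambda>x. u x *\<^sub>R gradient \<psi> x)" if "l2_loc u"
    using S(3) by (rule integrable_l2_loc_scaleR_continuous[OF that S(1) test_function_continuous_gradient[OF \<psi>]])
qed

lemma has_weak_gradient_unique:
  assumes "has_weak_gradient u g" "has_weak_gradient u g'" "l2_loc g" "l2_loc g'"
  shows "AE x in lebesgue. g x = g' x"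
proof -
  have l2: "l2_loc (\<lambda>x. g x + (- 1) *\<^sub>R g' x)"
    by (intro l2_loc_add l2_loc_scaleR assms)
  have "(LINT x|lebesgue. \<psi> x *\<^sub>R (g x + (- 1) *\<^sub>R g' x)) = 0" if \<psi>: "test_function \<psi>" for \<psi>
  proof -
    have "- (LINT x|lebesgue. \<psi> x *\<^sub>R g x) = - (LINT x|lebesgue. \<psi> x *\<^sub>R g' x)"
      using assms(1,2)[unfolded has_weak_gradient_def, rule_format, OF \<psi>] by (rule trans[OF sym])
    then show ?thesis
      using test_function_integrable(1)[OF \<psi> assms(3)] test_function_integrable(1)[OF \<psi> assms(4)]
      by (simp add: scaleR_diff_right)
  qed
  from fundamental_lemma_of_variations[OF l2 this]
  show ?thesis by simp
qed

text \<open>The integral splits only over integrable summands. Local square integrability of the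
  functions and of their gradients, together with the compact support of \<psi>, supplies
  this.\<close>

lemma has_weak_gradient_lincomb:
  assumes u: "l2_loc u" "l2_loc u'" and g: "l2_loc g" "l2_loc g'"
    and "has_weak_gradient u g" "has_weak_gradient u' g'"
  shows "has_weak_gradient (\<lambda>x. a * u x + b * u' x) (\<lambda>x. a *\<^sub>R g x + b *\<^sub>R g' x)"
  unfolding has_weak_gradient_def
proof (intro allI impI)
  fix \<psi> :: "real^'a \<Rightarrow> real" assume \<psi>: "test_function \<psi>"
  note int = test_function_integrable(2)[OF \<psi> u(1)] test_function_integrable(2)[OF \<psi> u(2)]
    test_function_integrable(1)[OF \<psi> g(1)] test_function_integrable(1)[OF \<psi> g(2)]
  have "(LINT x|lebesgue. (a * u x + b * u' x) *\<^sub>R gradient \<psi> x)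
      = (LINT x|lebesgue. a *\<^sub>R (u x *\<^sub>R gradient \<psi> x) + b *\<^sub>R (u' x *\<^sub>R gradient \<psi> x))"
    by (simp add: scaleR_add_left)
  also have "\<dots> = a *\<^sub>R (LINT x|lebesgue. u x *\<^sub>R gradient \<psi> x) + b *\<^sub>R (LINT x|lebesgue. u' x *\<^sub>R gradient \<psi> x)"
    by (subst Bochner_Integration.integral_add)
      (intro integrable_scaleR_right int | simp only: integral_scaleR_right)+
  also have "\<dots> = - (a *\<^sub>R (LINT x|lebesgue. \<psi> x *\<^sub>R g x) + b *\<^sub>R (LINT x|lebesgue. \<psi> x *\<^sub>R g' x))"
    using assms(5,6) \<psi> by (simp add: has_weak_gradient_def)
  also have "\<dots> = - (LINT x|lebesgue. a *\<^sub>R (\<psi> x *\<^sub>R g x) + b *\<^sub>R (\<psi> x *\<^sub>R g' x))"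
    by (subst Bochner_Integration.integral_add)
      (intro integrable_scaleR_right int | simp only: integral_scaleR_right)+
  also have "\<dots> = - (LINT x|lebesgue. \<psi> x *\<^sub>R (a *\<^sub>R g x + b *\<^sub>R g' x))"
    by (simp add: scaleR_add_right mult.commute)
  finally show "(LINT x|lebesgue. (a * u x + b * u' x) *\<^sub>R gradient \<psi> x)
      = - (LINT x|lebesgue. \<psi> x *\<^sub>R (a *\<^sub>R g x + b *\<^sub>R g' x))" .
qed

text \<open>The step sizes 1/(n+1) turn the directional derivative into a limit of a sequence, as
  dominated convergence requires.\<close>

lemma test_function_difference_quotient:
  assumes "test_function \<psi>"
  shows "(\<lambda>n. real (Suc n) * (\<psi> (x + (1 / real (Suc n)) *\<^sub>R e) - \<psi> x)) \<longlonglongrightarrow> gradient \<psi> x \<bullet> e"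
proof -
  have "((\<lambda>t. x + t *\<^sub>R e) has_derivative (\<lambda>t. t *\<^sub>R e)) (at 0)"
    by (auto intro!: derivative_eq_intros)
  moreover have "(\<psi> has_derivative (\<lambda>h. gradient \<psi> x \<bullet> h)) (at (x + 0 *\<^sub>R e))"
    using test_function_has_derivative[OF assms] by simp
  ultimately have "((\<lambda>t. \<psi> (x + t *\<^sub>R e)) has_derivative (\<lambda>t. gradient \<psi> x \<bullet> (t *\<^sub>R e))) (at 0)"
    by (rule has_derivative_compose)
  then have "((\<lambda>t. \<psi> (x + t *\<^sub>R e)) has_real_derivative gradient \<psi> x \<bullet> e) (at 0)"
    by (rule has_derivative_imp_has_field_derivative) (simp add: mult.commute)
  then have "((\<lambda>t. (\<psi> (x + t *\<^sub>R e) - \<psi> x) / t) \<longlongrightarrow> gradient \<psi> x \<bullet> e) (at 0)"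
    by (simp add: DERIV_def)
  moreover have "filterlim (\<lambda>n. 1 / real (Suc n)) (at 0) sequentially"
    unfolding filterlim_at using LIMSEQ_inverse_real_of_nat by (simp add: inverse_eq_divide)
  ultimately have "(\<lambda>n. (\<psi> (x + (1 / real (Suc n)) *\<^sub>R e) - \<psi> x) / (1 / real (Suc n))) \<longlonglongrightarrow> gradient \<psi> x \<bullet> e"
    by (rule filterlim_compose)
  then show ?thesis by (simp add: mult.commute)
qed

text \<open>By translation invariance the difference quotients of a test function have integral zero.\<close>

lemma integral_gradient_test_function:
  assumes \<psi>: "test_function \<psi>"
  shows "(LINT x|lebesgue. gradient \<psi> x) = 0"
proof -
  obtain S where S: "compact S" "\<And>x. x \<notin> S \<Longrightarrow> \<psi> x = 0" "\<And>x. x \<notin> S \<Longrightarrow> gradient \<psi> x = 0"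
    using test_function_support[OF \<psi>] by blast
  obtain L where L: "L \<ge> 0" "\<And>x. x \<in> S \<Longrightarrow> norm (gradient \<psi> x) \<le> L"
    using continuous_compact_bound[OF test_function_continuous_gradient[OF \<psi>] S(1)] by blast
  have L: "norm (gradient \<psi> x) \<le> L" for x
    using L S(3) by (cases "x \<in> S") auto
  \<comment> \<open>Mean value inequality. It bounds the difference quotients uniformly in n, which
    yields the dominating function below.\<close>
  have Lip: "\<bar>\<psi> x - \<psi> y\<bar> \<le> L * norm (x - y)" for x y
  proof -
    have "onorm (\<lambda>h. gradient \<psi> z \<bullet> h) \<le> L" for z
    proof (rule onorm_bound)
      show "norm (gradient \<psi> z \<bullet> h) \<le> L * norm h" for h
        using Cauchy_Schwarz_ineq2[of "gradient \<psi> z" h] mult_right_mono[OF L[of z] norm_ge_zero[of h]]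
        by simp
      show "0 \<le> L" using L[of z] norm_ge_zero[of "gradient \<psi> z"] by linarith
    qed
    then show ?thesis
      using differentiable_bound[OF convex_UNIV, of \<psi> "\<lambda>z h. gradient \<psi> z \<bullet> h" L x y]
        test_function_has_derivative[OF \<psi>] by simp
  qed
  obtain R where R: "\<And>x. x \<in> S \<Longrightarrow> norm x \<le> R"
    using compact_imp_bounded[OF S(1)] by (auto simp: bounded_iff)
  have [measurable]: "\<psi> \<in> borel_measurable borel" "gradient \<psi> \<in> borel_measurable borel"
    using test_function_continuous[OF \<psi>] test_function_continuous_gradient[OF \<psi>]
    by (auto intro: borel_measurable_continuous_onI)
  \<comment> \<open>The argument moves to \<open>lborel\<close>, where
    \<open>lborel_distr_plus\<close> expresses translation invariance. Pairing with the constant 1,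
    which is in \<open>l2_loc\<close>, gives integrability of \<psi> and of its gradient.\<close>
  have int_\<psi>: "integrable lborel \<psi>"
    using test_function_integrable(1)[OF \<psi> l2_loc_const[of "1::real"]]
    by (simp add: integrable_completion)
  have int_grad: "integrable lborel (gradient \<psi>)"
    using test_function_integrable(2)[OF \<psi> l2_loc_const[of "1::real"]]
    by (simp add: integrable_completion)
  have component: "(LINT x|lborel. gradient \<psi> x) \<bullet> e = 0" for e
  proof -
    define F where "F = (\<lambda>n x. real (Suc n) * (\<psi> (x + (1 / real (Suc n)) *\<^sub>R e) - \<psi> x))"
    have int_F: "(LINT x|lborel. F n x) = 0" for n
    proof -
      have eq: "(LINT x|lborel. \<psi> (c + x)) = (LINT x|lborel. \<psi> x)"
        and int: "integrable lborel (\<lambda>x. \<psi> (c + x))" for c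
        using integral_distr[of "(+) c" lborel borel \<psi>] integrable_distr[of "(+) c" lborel borel \<psi>] int_\<psi>
        by (simp_all add: lborel_distr_plus)
      have "(LINT x|lborel. F n x)
          = real (Suc n) * ((LINT x|lborel. \<psi> ((1 / real (Suc n)) *\<^sub>R e + x)) - (LINT x|lborel. \<psi> x))"
        unfolding F_def add.commute[of _ "(1 / real (Suc n)) *\<^sub>R e"] using int int_\<psi>
        by (simp only: integral_mult_right_zero Bochner_Integration.integral_diff)
      then show ?thesis
        by (simp only: eq) simp
    qed
    \<comment> \<open>The shift e/(n+1) is no longer than e. Outside the ball of radius R + |e| both
      x and the shifted point therefore have norm above R and lie off the support.\<close>
    have bound: "norm (F n x) \<le> indicator (cball 0 (R + norm e)) x *\<^sub>R (L * norm e)" for n x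
    proof (cases "x \<in> cball 0 (R + norm e)")
      case True
      have "\<bar>\<psi> (x + (1 / real (Suc n)) *\<^sub>R e) - \<psi> x\<bar> \<le> L * ((1 / real (Suc n)) * norm e)"
        using Lip[of "x + (1 / real (Suc n)) *\<^sub>R e" x] by simp
      then have "real (Suc n) * \<bar>\<psi> (x + (1 / real (Suc n)) *\<^sub>R e) - \<psi> x\<bar> \<le> real (Suc n) * (L * ((1 / real (Suc n)) * norm e))"
        by (rule mult_left_mono) simp
      also have "\<dots> = L * norm e" by simp
      finally show ?thesis using True by (simp add: F_def abs_mult)
    next
      case False
      then have x: "norm x > R + norm e" by simp
      have "norm ((1 / real (Suc n)) *\<^sub>R e) \<le> norm e"
        by (simp add: divide_le_eq mult_le_cancel_left1)
      then have "norm (x + (1 / real (Suc n)) *\<^sub>R e) > R"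
        using x norm_triangle_ineq2[of x "- ((1 / real (Suc n)) *\<^sub>R e)"] by simp
      moreover have "norm x > R" using x norm_ge_zero[of e] by linarith
      ultimately have "\<psi> (x + (1 / real (Suc n)) *\<^sub>R e) = 0" "\<psi> x = 0"
        using R S(2) by (meson not_less)+
      then show ?thesis using False by (simp add: F_def)
    qed
    have "(\<lambda>n. LINT x|lborel. F n x) \<longlonglongrightarrow> (LINT x|lborel. gradient \<psi> x \<bullet> e)"
    proof (rule integral_dominated_convergence)
      show "integrable lborel (\<lambda>x. indicator (cball 0 (R + norm e)) x *\<^sub>R (L * norm e))"
        by (rule integrable_indicator) (use emeasure_bounded_finite[OF bounded_cball] in auto)
      show "AE x in lborel. (\<lambda>n. F n x) \<longlonglongrightarrow> gradient \<psi> x \<bullet> e"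
        unfolding F_def by (intro AE_I2 test_function_difference_quotient \<psi>)
      show "AE x in lborel. norm (F n x) \<le> indicator (cball 0 (R + norm e)) x *\<^sub>R (L * norm e)" for n
        by (intro AE_I2 bound)
    qed (simp_all add: F_def)
    then have "(LINT x|lborel. gradient \<psi> x \<bullet> e) = 0"
      by (simp add: int_F LIMSEQ_const_iff)
    then show ?thesis
      using integral_bounded_linear[OF bounded_linear_inner_left int_grad, of e] by simp
  qed
  \<comment> \<open>Choosing e as the integral itself makes the integral orthogonal to
    itself.\<close>
  have "(LINT x|lborel. gradient \<psi> x) = 0"
    using component[of "LINT x|lborel. gradient \<psi> x"] by simp
  then show ?thesis by (simp add: integral_completion)
qed

lemma has_weak_gradient_const: "has_weak_gradient (\<lambda>x. c) (\<lambda>x. 0)"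
  unfolding has_weak_gradient_def by (simp add: integral_gradient_test_function)

lemma weak_grad_props:
  assumes "u \<in> H1_per \<Lambda>"
  shows "l2_loc (weak_grad u)" and "has_weak_gradient u (weak_grad u)"
proof -
  have "\<exists>g. l2_loc g \<and> has_weak_gradient u g"
    using assms by (simp add: H1_per_def)
  then have "l2_loc (weak_grad u) \<and> has_weak_gradient u (weak_grad u)"
    unfolding weak_grad_def by (rule someI_ex)
  then show "l2_loc (weak_grad u)" "has_weak_gradient u (weak_grad u)" by auto
qed

text \<open>This is how \<open>weak_grad\<close> is computed: exhibit any weak gradient in
  \<open>l2_loc\<close> and identify it with the choice by uniqueness.\<close>

lemma weak_grad_AE_eq:
  assumes "u \<in> H1_per \<Lambda>" "has_weak_gradient u g" "l2_loc g"
  shows "AE x in lebesgue. weak_grad u x = g x"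
  by (rule has_weak_gradient_unique[OF weak_grad_props(2)[OF assms(1)] assms(2) weak_grad_props(1)[OF assms(1)] assms(3)])

text \<open>\<open>dtau\<close> is the case a = 1/\<tau>, b = -1/\<tau>. Membership has to come
  first: it provides the witness by which \<open>weak_grad\<close> of the combination is a genuine
  weak gradient.\<close>

lemma H1_per_lincomb:
  assumes "u \<in> H1_per \<Lambda>" "u' \<in> H1_per \<Lambda>"
  shows "(\<lambda>x. a * u x + b * u' x) \<in> H1_per \<Lambda>"
    and "AE x in lebesgue. weak_grad (\<lambda>x. a * u x + b * u' x) x = a *\<^sub>R weak_grad u x + b *\<^sub>R weak_grad u' x"
proof -
  have l2: "l2_loc u" "l2_loc u'" and per: "periodic \<Lambda> u" "periodic \<Lambda> u'"
    using assms by (auto simp: H1_per_def)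
  have g: "l2_loc (\<lambda>x. a *\<^sub>R weak_grad u x + b *\<^sub>R weak_grad u' x)"
    using assms by (intro l2_loc_add l2_loc_scaleR weak_grad_props)
  have "l2_loc (\<lambda>x. a * u x + b * u' x)"
    using l2_loc_add[OF l2_loc_scaleR[OF l2(1), of a] l2_loc_scaleR[OF l2(2), of b]] by simp
  moreover have "periodic \<Lambda> (\<lambda>x. a * u x + b * u' x)"
    unfolding periodic_def
  proof
    fix l assume l: "l \<in> \<Lambda>"
    have "AE x in lebesgue. u (l + x) = u x" "AE x in lebesgue. u' (l + x) = u' x"
      using per l by (auto simp: periodic_def)
    then show "AE x in lebesgue. a * u (l + x) + b * u' (l + x) = a * u x + b * u' x"
      by eventually_elim simp
  qed
  moreover have w: "has_weak_gradient (\<lambda>x. a * u x + b * u' x) (\<lambda>x. a *\<^sub>R weak_grad u x + b *\<^sub>R weak_grad u' x)"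
    using assms by (intro has_weak_gradient_lincomb l2 weak_grad_props)
  ultimately show H1: "(\<lambda>x. a * u x + b * u' x) \<in> H1_per \<Lambda>"
    using g unfolding H1_per_def by blast
  show "AE x in lebesgue. weak_grad (\<lambda>x. a * u x + b * u' x) x = a *\<^sub>R weak_grad u x + b *\<^sub>R weak_grad u' x"
    by (rule weak_grad_AE_eq[OF H1 w g])
qed

lemma H1_per_const:
  fixes \<Lambda> :: "(real^'d) set"
  shows "(\<lambda>x. c) \<in> H1_per \<Lambda>" and "AE x in lebesgue. weak_grad (\<lambda>x::real^'d. c) x = 0"
proof -
  show H1: "(\<lambda>x. c) \<in> H1_per \<Lambda>"
    using has_weak_gradient_const[of c] l2_loc_const[of c] l2_loc_const[of "0::real^'d"]
    by (auto simp: H1_per_def periodic_def)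
  show "AE x in lebesgue. weak_grad (\<lambda>x::real^'d. c) x = 0"
    using weak_grad_AE_eq[OF H1, of "\<lambda>_. 0"] has_weak_gradient_const l2_loc_const by blast
qed

section \<open>Finite element functions\<close>

lemma polys_lincomb:
  assumes "p \<in> polys k" "q \<in> polys k"
  shows "(\<lambda>x. a * p x + b * q x) \<in> polys k"
proof -
  obtain c d where "p = (\<lambda>x. \<Sum>\<alpha> | sum \<alpha> UNIV \<le> k. c \<alpha> * (\<Prod>i\<in>UNIV. (x $ i) ^ \<alpha> i))"
    and "q = (\<lambda>x. \<Sum>\<alpha> | sum \<alpha> UNIV \<le> k. d \<alpha> * (\<Prod>i\<in>UNIV. (x $ i) ^ \<alpha> i))"
    using assms unfolding polys_def by (auto simp: fun_eq_iff)
  then have "a * p x + b * q x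
      = (\<Sum>\<alpha> | sum \<alpha> UNIV \<le> k. (a * c \<alpha> + b * d \<alpha>) * (\<Prod>i\<in>UNIV. (x $ i) ^ \<alpha> i))" for x
    by (simp add: sum_distrib_left sum.distrib algebra_simps)
  then show ?thesis unfolding polys_def by (auto intro!: exI[of _ "\<lambda>\<alpha>. a * c \<alpha> + b * d \<alpha>"])
qed

lemma polys_const: "(\<lambda>x::real^'d. c) \<in> polys k"
proof -
  \<comment> \<open>The constant is the coefficient of the zero multi-index, whose monomial is
    1.\<close>
  have "(\<Sum>\<alpha> | sum \<alpha> UNIV \<le> k. (if \<alpha> = (\<lambda>_. 0) then c else 0) * (\<Prod>i\<in>UNIV. (x $ i) ^ \<alpha> i))
      = (\<Sum>\<alpha> :: 'd \<Rightarrow> nat | sum \<alpha> UNIV \<le> k. if \<alpha> = (\<lambda>_. 0) then c else 0)" for x :: "real^'d"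
    by (intro sum.cong) auto
  also have "\<dots> = c"
    by (subst sum.delta) (auto simp: finite_multi_indices)
  finally show ?thesis
    unfolding polys_def by (auto intro!: exI[of _ "\<lambda>\<alpha>. if \<alpha> = (\<lambda>_. 0) then c else 0"])
qed

lemma polys_continuous:
  assumes "p \<in> polys k"
  shows "continuous_on S p"
proof -
  obtain c where "p = (\<lambda>x. \<Sum>\<alpha> | sum \<alpha> UNIV \<le> k. c \<alpha> * (\<Prod>i\<in>UNIV. (x $ i) ^ \<alpha> i))"
    using assms unfolding polys_def by (auto simp: fun_eq_iff)
  then show ?thesis by (auto intro!: continuous_intros)
qed

lemma P_cont_lincomb:
  assumes "u \<in> P_cont k \<Lambda> Th" "u' \<in> P_cont k \<Lambda> Th"
  shows "(\<lambda>x. a * u x + b * u' x) \<in> P_cont k \<Lambda> Th"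
proof -
  have "piecewise_poly k Th (\<lambda>x. a * u x + b * u' x)"
    unfolding piecewise_poly_def
  proof
    fix K assume "K \<in> Th"
    then obtain p q where pq: "p \<in> polys k" "q \<in> polys k"
      and ae: "AE x in lebesgue_on K. u x = p x" "AE x in lebesgue_on K. u' x = q x"
      using assms unfolding P_cont_def piecewise_poly_def by blast
    from ae have "AE x in lebesgue_on K. a * u x + b * u' x = a * p x + b * q x"
      by eventually_elim simp
    then show "\<exists>r\<in>polys k. AE x in lebesgue_on K. a * u x + b * u' x = r x"
      using polys_lincomb[OF pq] by (rule bexI)
  qed
  then show ?thesis
    using assms H1_per_lincomb(1) by (auto simp: P_cont_def)
qed

lemma P_cont_const: "(\<lambda>x. c) \<in> P_cont k \<Lambda> Th"
proof -
  have "piecewise_poly k Th (\<lambda>x. c)"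
    unfolding piecewise_poly_def by (intro ballI bexI[OF _ polys_const[of c]]) simp
  then show ?thesis using H1_per_const(1) by (simp add: P_cont_def)
qed

text \<open>On each compact simplex the function agrees almost everywhere with a polynomial, which
  is bounded there; finitely many simplices cover \<Omega>.\<close>

lemma P_cont_AE_bounded:
  assumes u: "u \<in> P_cont k \<Lambda> Th" and Th: "finite Th" "\<And>K. K \<in> Th \<Longrightarrow> compact K"
    and \<Omega>: "\<Omega> \<subseteq> \<Union>Th" "\<Omega> \<in> sets lebesgue"
  obtains B where "AE x in lebesgue_on \<Omega>. \<bar>u x\<bar> \<le> B"
proof -
  have "\<exists>B\<ge>0. AE x in lebesgue. x \<in> K \<longrightarrow> \<bar>u x\<bar> \<le> B" if K: "K \<in> Th" for K
  proof -
    obtain p where p: "p \<in> polys k" "AE x in lebesgue_on K. u x = p x"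
      using u K unfolding P_cont_def piecewise_poly_def by blast
    obtain B where B: "B \<ge> 0" "\<And>x. x \<in> K \<Longrightarrow> norm (p x) \<le> B"
      using continuous_compact_bound[OF polys_continuous[OF p(1)] Th(2)[OF K]] by blast
    have "K \<in> sets lebesgue"
      using Th(2)[OF K] by (simp add: lmeasurable_compact fmeasurableD)
    with p(2) have "AE x in lebesgue. x \<in> K \<longrightarrow> u x = p x"
      by (simp add: AE_restrict_space_iff)
    then have "AE x in lebesgue. x \<in> K \<longrightarrow> \<bar>u x\<bar> \<le> B"
      by eventually_elim (use B(2) in auto)
    then show ?thesis using B(1) by blast
  qed
  then obtain B where B: "\<And>K. K \<in> Th \<Longrightarrow> B K \<ge> 0" "\<And>K. K \<in> Th \<Longrightarrow> AE x in lebesgue. x \<in> K \<longrightarrow> \<bar>u x\<bar> \<le> B K"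
    by metis
  have "AE x in lebesgue. \<forall>K\<in>Th. x \<in> K \<longrightarrow> \<bar>u x\<bar> \<le> B K"
    using B(2) Th(1) by (intro AE_finite_allI)
  \<comment> \<open>The local bounds are nonnegative, so their sum dominates each of them and serves
    as a common bound.\<close>
  then have "AE x in lebesgue. x \<in> \<Omega> \<longrightarrow> \<bar>u x\<bar> \<le> sum B Th"
  proof eventually_elim
    case (elim x)
    show ?case
    proof
      assume "x \<in> \<Omega>"
      then obtain K where K: "K \<in> Th" "x \<in> K" using \<Omega>(1) by blast
      then have "\<bar>u x\<bar> \<le> B K" using elim by blast
      also have "\<dots> \<le> sum B Th" using K(1) B(1) Th(1) by (intro member_le_sum) auto
      finally show "\<bar>u x\<bar> \<le> sum B Th" .
    qed
  qed
  then show ?thesis using that \<Omega>(2) by (simp add: AE_restrict_space_iff)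
qed

text \<open>By boundedness of u only the values of f on a compact interval matter, so f(u) is
  bounded almost everywhere on a set of finite measure, whatever the growth of f.\<close>

lemma P_cont_comp_integrable:
  assumes u: "u \<in> P_cont k \<Lambda> Th" and Th: "finite Th" "\<And>K. K \<in> Th \<Longrightarrow> compact K"
    and \<Omega>: "\<Omega> \<subseteq> \<Union>Th" "bounded \<Omega>" "\<Omega> \<in> sets lebesgue" and f: "continuous_on UNIV f"
  shows "integrable (lebesgue_on \<Omega>) (\<lambda>x. f (u x) :: real)"
proof -
  obtain B where B: "AE x in lebesgue_on \<Omega>. \<bar>u x\<bar> \<le> B"
    using P_cont_AE_bounded[OF u Th \<Omega>(1,3)] by blast
  have "bounded (f ` {- B..B})"
    by (meson compact_Icc compact_continuous_image compact_imp_bounded continuous_on_subset f subset_UNIV)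
  then obtain C where C: "\<And>s. s \<in> {- B..B} \<Longrightarrow> norm (f s) \<le> C"
    unfolding bounded_iff by blast
  have "l2_loc u" using u by (simp add: P_cont_def H1_per_def)
  then have [measurable]: "u \<in> borel_measurable (lebesgue_on \<Omega>)"
    using l2_loc_imp_square_integrable[of u \<Omega>] \<Omega> by (simp add: square_integrable_def)
  have [measurable]: "f \<in> borel_measurable borel"
    using f by (rule borel_measurable_continuous_onI)
  have fin: "finite_measure (lebesgue_on \<Omega>)"
    using \<Omega> by (intro finite_measure_lebesgue_on) (simp add: bounded_set_imp_lmeasurable)
  have "AE x in lebesgue_on \<Omega>. norm (f (u x)) \<le> C"
    using B by eventually_elim (use C in \<open>simp add: abs_le_iff\<close>)
  then show ?thesis
    by (rule finite_measure.integrable_const_bound[OF fin]) measurable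
qed

section \<open>Energy estimates\<close>

lemma periodic_mesh_facts:
  assumes "periodic_domain \<Lambda> \<Omega>" "periodic_triangulation \<Lambda> \<Omega> Th"
  shows "finite Th" "\<And>K. K \<in> Th \<Longrightarrow> compact K" "\<Omega> \<subseteq> \<Union>Th" "bounded \<Omega>" "\<Omega> \<in> sets lebesgue" "\<Omega> \<in> lmeasurable"
proof -
  show "finite Th"
    using assms(2) by (simp add: periodic_triangulation_def triangulation_def)
  show "compact K" if "K \<in> Th" for K
    using assms(2) that by (auto simp: periodic_triangulation_def intro: compact_simplex)
  show "\<Omega> \<subseteq> \<Union>Th"
    using assms(2) closure_subset by (auto simp: periodic_triangulation_def)
  show "bounded \<Omega>"
    using assms(1) by (simp add: periodic_domain_def)
  have "open \<Omega>"
    using assms(1) by (simp add: periodic_domain_def)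
  then show "\<Omega> \<in> sets lebesgue"
    by (simp add: borel_open)
  with \<open>bounded \<Omega>\<close> show "\<Omega> \<in> lmeasurable"
    by (rule bounded_set_imp_lmeasurable)
qed

section \<open>Pairings and square integrability over the cell\<close>

lemma l2_commute: "l2 \<Omega> u w = l2 \<Omega> w u"
  by (simp add: l2_def inner_commute)

lemma AE_lebesgue_imp_AE_lebesgue_on:
  assumes "AE x in lebesgue. P x" "S \<in> sets lebesgue"
  shows "AE x in lebesgue_on S. P x"
  using assms by (simp add: AE_restrict_space_iff eventually_mono)

text \<open>The integrand is zero almost everywhere whatever w is, so the lemma applies directly to
  the nonlinear fluxes.\<close>

lemma l2_weak_grad_const:
  assumes "\<Omega> \<in> sets lebesgue"
  shows "l2 \<Omega> w (weak_grad (\<lambda>x. c)) = 0"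
proof -
  have "AE x in lebesgue_on \<Omega>. weak_grad (\<lambda>x. c) x = 0"
    using assms by (rule AE_lebesgue_imp_AE_lebesgue_on[OF H1_per_const(2)])
  then have "AE x in lebesgue_on \<Omega>. w x \<bullet> weak_grad (\<lambda>x. c) x = 0"
    by eventually_elim simp
  then show ?thesis unfolding l2_def by (rule integral_eq_zero_AE)
qed

lemma P_cont_square_integrable:
  assumes "u \<in> P_cont k \<Lambda> Th" "bounded \<Omega>" "\<Omega> \<in> sets lebesgue"
  shows "square_integrable \<Omega> u" and "square_integrable \<Omega> (weak_grad u)"
proof -
  have "u \<in> H1_per \<Lambda>" using assms(1) by (simp add: P_cont_def)
  then have "l2_loc u" "l2_loc (weak_grad u)"
    using weak_grad_props(1)[of u] by (auto simp: H1_per_def)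
  then show "square_integrable \<Omega> u" "square_integrable \<Omega> (weak_grad u)"
    using assms(2,3) by (auto intro: l2_loc_imp_square_integrable)
qed

lemma Xh_square_integrable:
  assumes "v \<in> Xh \<Lambda> Th" "bounded \<Omega>" "\<Omega> \<in> sets lebesgue"
  shows "square_integrable \<Omega> v"
proof -
  have c: "square_integrable \<Omega> (\<lambda>x. v x $ i)" for i
    using assms(1) by (intro P_cont_square_integrable(1)[OF _ assms(2,3), of _ 2 \<Lambda> Th]) (simp add: Xh_def)
  have "v \<in> borel_measurable (lebesgue_on \<Omega>)"
    using c by (subst borel_measurable_euclidean_space) (auto simp: Basis_vec_def inner_axis square_integrable_def)
  moreover have "integrable (lebesgue_on \<Omega>) (\<lambda>x. \<Sum>i\<in>UNIV. (norm (v x $ i))\<^sup>2)"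
    using c by (intro Bochner_Integration.integrable_sum) (simp add: square_integrable_def)
  moreover have "(norm (v x))\<^sup>2 = (\<Sum>i\<in>UNIV. (norm (v x $ i))\<^sup>2)" for x
    by (simp add: norm_vec_def L2_set_def sum_nonneg)
  ultimately show ?thesis by (simp add: square_integrable_def)
qed

section \<open>Nodal values, interval values and difference quotients in time\<close>

lemma nodal_in_Pi1c:
  assumes "g \<in> Pi1c \<Omega> \<tau> N X" "\<tau> > 0" "n \<le> N"
  shows "nodal \<tau> g n \<in> X"
  using assms by (auto simp: Pi1c_def nodal_def tn_def)

lemma midval_in_Pi0:
  assumes "g \<in> Pi0 \<Omega> \<tau> N X" "\<tau> > 0" "n < N"
  shows "midval \<tau> g (Suc n) \<in> X"
proof -
  have "tn \<tau> (Suc n) - \<tau> / 2 \<in> {tn \<tau> n<..<tn \<tau> (Suc n)}"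
    using assms(2) by (simp add: tn_def algebra_simps)
  then show ?thesis
    using assms unfolding Pi0_def midval_def by blast
qed

lemma dtau_eq_lincomb:
  fixes \<phi> :: "real \<Rightarrow> real^'d \<Rightarrow> real"
  shows "dtau \<tau> (Suc n) \<phi> = (\<lambda>x. (1 / \<tau>) * nodal \<tau> \<phi> (Suc n) x + (- 1 / \<tau>) * nodal \<tau> \<phi> n x)"
  by (auto simp: dtau_def divide_inverse algebra_simps)

lemma dtau_in_P_cont:
  assumes "nodal \<tau> \<phi> (Suc n) \<in> P_cont k \<Lambda> Th" "nodal \<tau> \<phi> n \<in> P_cont k \<Lambda> Th"
  shows "dtau \<tau> (Suc n) \<phi> \<in> P_cont k \<Lambda> Th"
  unfolding dtau_eq_lincomb by (rule P_cont_lincomb[OF assms])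

lemma dtau_mass:
  fixes \<phi> :: "real \<Rightarrow> real^'d \<Rightarrow> real"
  assumes "integrable (lebesgue_on \<Omega>) (nodal \<tau> \<phi> (Suc n))" "integrable (lebesgue_on \<Omega>) (nodal \<tau> \<phi> n)"
    and "\<tau> > 0"
  shows "\<tau> * l2 \<Omega> (dtau \<tau> (Suc n) \<phi>) (\<lambda>x. 1) = l2 \<Omega> (nodal \<tau> \<phi> (Suc n)) (\<lambda>x. 1) - l2 \<Omega> (nodal \<tau> \<phi> n) (\<lambda>x. 1)"
  using assms by (simp add: l2_def dtau_def)

text \<open>The average of \<open>f'\<close> along the segment is the difference quotient of \<open>f\<close>, multiplied out so that
  it also holds where the two nodal values coincide.\<close>

lemma avg_deriv_mult_dtau:
  assumes f: "\<And>s. (f has_real_derivative deriv f s) (at s)" and \<tau>: "\<tau> > 0"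
  shows "avg_deriv \<tau> f \<phi> n x * dtau \<tau> (Suc n) \<phi> x = (f (nodal \<tau> \<phi> (Suc n) x) - f (nodal \<tau> \<phi> n x)) / \<tau>"
proof -
  define a where "a = nodal \<tau> \<phi> n x"
  define c where "c = (nodal \<tau> \<phi> (Suc n) x - nodal \<tau> \<phi> n x) / \<tau>"
  have tn: "tn \<tau> (Suc n) = tn \<tau> n + \<tau>" by (simp add: tn_def algebra_simps)
  have "((\<lambda>s. f (c * (s - tn \<tau> n) + a)) has_vector_derivative c * deriv f (c * (s - tn \<tau> n) + a))
      (at s within {tn \<tau> n..tn \<tau> (Suc n)})" for s
  proof -
    have "((\<lambda>s. c * (s - tn \<tau> n) + a) has_real_derivative c) (at s)"
      by (auto intro!: derivative_eq_intros)
    from DERIV_chain2[OF f this]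
    have "((\<lambda>s. f (c * (s - tn \<tau> n) + a)) has_real_derivative c * deriv f (c * (s - tn \<tau> n) + a)) (at s)"
      by (simp add: mult.commute)
    then show ?thesis
      by (simp add: has_real_derivative_iff_has_vector_derivative has_vector_derivative_at_within)
  qed
  then have int: "((\<lambda>s. c * deriv f (c * (s - tn \<tau> n) + a)) has_integral
      (f (c * (tn \<tau> (Suc n) - tn \<tau> n) + a) - f (c * (tn \<tau> n - tn \<tau> n) + a))) {tn \<tau> n..tn \<tau> (Suc n)}"
    using \<tau> tn by (intro fundamental_theorem_of_calculus) auto
  have "c * integral {tn \<tau> n..tn \<tau> (Suc n)} (\<lambda>s. deriv f (c * (s - tn \<tau> n) + a)) = f (c * \<tau> + a) - f a"
    using integral_unique[OF int] by (simp add: tn)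
  moreover have "c * \<tau> + a = nodal \<tau> \<phi> (Suc n) x"
    using \<tau> by (simp add: c_def a_def)
  moreover have "dtau \<tau> (Suc n) \<phi> x = c"
    by (simp add: dtau_def c_def divide_inverse mult.commute)
  moreover have "avg_deriv \<tau> f \<phi> n x
      = (1 / \<tau>) * integral {tn \<tau> n..tn \<tau> (Suc n)} (\<lambda>s. deriv f (c * (s - tn \<tau> n) + a))"
    unfolding avg_deriv_def c_def a_def ..
  ultimately show ?thesis
    by (simp add: a_def mult.commute)
qed

section \<open>Energy increments over one time step\<close>

lemma E0_increment:
  assumes \<Omega>: "periodic_domain \<Lambda> \<Omega>" "periodic_triangulation \<Lambda> \<Omega> Th"
    and \<tau>: "\<tau> > 0" and \<gamma>: "\<gamma> > 0"
    and f: "\<And>s. (f has_real_derivative deriv f s) (at s)"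
    and \<phi>: "nodal \<tau> \<phi> (Suc n) \<in> P_cont k \<Lambda> Th" "nodal \<tau> \<phi> n \<in> P_cont k \<Lambda> Th"
  shows "E0 \<Omega> \<gamma> f (nodal \<tau> \<phi> (Suc n)) - E0 \<Omega> \<gamma> f (nodal \<tau> \<phi> n)
    \<le> \<tau> * (\<gamma> * l2 \<Omega> (weak_grad (nodal \<tau> \<phi> (Suc n))) (weak_grad (dtau \<tau> (Suc n) \<phi>))
        + l2 \<Omega> (avg_deriv \<tau> f \<phi> n) (dtau \<tau> (Suc n) \<phi>))"
proof -
  note mesh = periodic_mesh_facts[OF \<Omega>]
  define u0 where "u0 = nodal \<tau> \<phi> n"
  define u1 where "u1 = nodal \<tau> \<phi> (Suc n)"
  define g0 where "g0 = weak_grad u0"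
  define g1 where "g1 = weak_grad u1"
  have cont: "continuous_on UNIV f"
    using f DERIV_isCont by (auto simp: continuous_on_eq_continuous_at)
  have f0: "integrable (lebesgue_on \<Omega>) (\<lambda>x. f (u0 x))" and f1: "integrable (lebesgue_on \<Omega>) (\<lambda>x. f (u1 x))"
    unfolding u0_def u1_def
    using P_cont_comp_integrable[OF \<phi>(2) mesh(1-5) cont] P_cont_comp_integrable[OF \<phi>(1) mesh(1-5) cont] by auto
  have sq: "square_integrable \<Omega> g0" "square_integrable \<Omega> g1"
    unfolding g0_def g1_def u0_def u1_def
    using P_cont_square_integrable(2)[OF \<phi>(2) mesh(4,5)] P_cont_square_integrable(2)[OF \<phi>(1) mesh(4,5)] by auto
  have n0: "integrable (lebesgue_on \<Omega>) (\<lambda>x. (norm (g0 x))\<^sup>2)" and n1: "integrable (lebesgue_on \<Omega>) (\<lambda>x. (norm (g1 x))\<^sup>2)"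
    using sq by (auto simp: square_integrable_def)
  have i10: "integrable (lebesgue_on \<Omega>) (\<lambda>x. g1 x \<bullet> g0 x)" and i11: "integrable (lebesgue_on \<Omega>) (\<lambda>x. g1 x \<bullet> g1 x)"
    using sq by (auto intro: square_integrable_imp_integrable_inner)
  have iI: "integrable (lebesgue_on \<Omega>) (\<lambda>x. g1 x \<bullet> (g1 x - g0 x))"
    unfolding inner_diff_right using i10 i11 by (rule Bochner_Integration.integrable_diff[rotated])
  \<comment> \<open>The gradient of the difference quotient and the difference quotient of the
    gradients come from separate choices. They agree almost everywhere, hence may be exchanged under
    the integral.\<close>
  have dgrad: "l2 \<Omega> g1 (weak_grad (dtau \<tau> (Suc n) \<phi>)) = (LINT x|lebesgue_on \<Omega>. g1 x \<bullet> (g1 x - g0 x)) / \<tau>"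
  proof -
    have H1: "u1 \<in> H1_per \<Lambda>" "u0 \<in> H1_per \<Lambda>"
      using \<phi> by (auto simp: P_cont_def u0_def u1_def)
    have "AE x in lebesgue_on \<Omega>. weak_grad (dtau \<tau> (Suc n) \<phi>) x = (1 / \<tau>) *\<^sub>R g1 x + (- 1 / \<tau>) *\<^sub>R g0 x"
      unfolding dtau_eq_lincomb u0_def[symmetric] u1_def[symmetric] g0_def g1_def
      by (rule AE_lebesgue_imp_AE_lebesgue_on[OF H1_per_lincomb(2)[OF H1] mesh(5)])
    then have ae: "AE x in lebesgue_on \<Omega>. g1 x \<bullet> weak_grad (dtau \<tau> (Suc n) \<phi>) x = (g1 x \<bullet> (g1 x - g0 x)) / \<tau>"
      by eventually_elim (simp add: inner_diff_right inner_add_right diff_divide_distrib)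
    have "square_integrable \<Omega> (weak_grad (dtau \<tau> (Suc n) \<phi>))"
      by (rule P_cont_square_integrable(2)[OF dtau_in_P_cont[OF \<phi>] mesh(4,5)])
    then have "integrable (lebesgue_on \<Omega>) (\<lambda>x. g1 x \<bullet> weak_grad (dtau \<tau> (Suc n) \<phi>) x)"
      by (rule square_integrable_imp_integrable_inner[OF sq(2)])
    then have "l2 \<Omega> g1 (weak_grad (dtau \<tau> (Suc n) \<phi>)) = (LINT x|lebesgue_on \<Omega>. (g1 x \<bullet> (g1 x - g0 x)) / \<tau>)"
      unfolding l2_def using iI ae by (intro integral_cong_AE) auto
    then show ?thesis by simp
  qed
  \<comment> \<open>The integrands agree at every point, so the increment of f(\<phi>) takes over
    and \<open>avg_deriv\<close> need not be integrated on its own.\<close>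
  have davg: "l2 \<Omega> (avg_deriv \<tau> f \<phi> n) (dtau \<tau> (Suc n) \<phi>) = (LINT x|lebesgue_on \<Omega>. f (u1 x) - f (u0 x)) / \<tau>"
    unfolding l2_def inner_real_def avg_deriv_mult_dtau[OF f \<tau>] u0_def u1_def by simp
  have "E0 \<Omega> \<gamma> f u1 - E0 \<Omega> \<gamma> f u0
      = (LINT x|lebesgue_on \<Omega>. (\<gamma> / 2 * (norm (g1 x))\<^sup>2 + f (u1 x)) - (\<gamma> / 2 * (norm (g0 x))\<^sup>2 + f (u0 x)))"
    unfolding E0_def g0_def[symmetric] g1_def[symmetric]
    by (intro Bochner_Integration.integral_diff[symmetric] Bochner_Integration.integrable_add
        integrable_mult_right n0 n1 f0 f1)
  also have "\<dots> \<le> (LINT x|lebesgue_on \<Omega>. \<gamma> * (g1 x \<bullet> (g1 x - g0 x)) + (f (u1 x) - f (u0 x)))"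
  proof (rule integral_mono)
    fix x
    \<comment> \<open>This term is exactly the gap between the two sides: the numerical dissipation
      of the implicit gradient term, and the source of the inequality in place of an
      equality.\<close>
    have "\<gamma> / 2 * (norm (g1 x - g0 x))\<^sup>2 \<ge> 0" using \<gamma> by simp
    then show "(\<gamma> / 2 * (norm (g1 x))\<^sup>2 + f (u1 x)) - (\<gamma> / 2 * (norm (g0 x))\<^sup>2 + f (u0 x))
        \<le> \<gamma> * (g1 x \<bullet> (g1 x - g0 x)) + (f (u1 x) - f (u0 x))"
      by (simp add: power2_norm_eq_inner inner_diff_left inner_diff_right inner_commute algebra_simps)
  qed (intro Bochner_Integration.integrable_diff Bochner_Integration.integrable_add
        integrable_mult_right n0 n1 f0 f1 iI)+
  also have "\<dots> = \<gamma> * (LINT x|lebesgue_on \<Omega>. g1 x \<bullet> (g1 x - g0 x)) + (LINT x|lebesgue_on \<Omega>. f (u1 x) - f (u0 x))"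
    by (subst Bochner_Integration.integral_add)
      (intro Bochner_Integration.integrable_diff integrable_mult_right f0 f1 iI | simp only: integral_mult_right_zero)+
  also have "\<dots> = \<tau> * (\<gamma> * l2 \<Omega> g1 (weak_grad (dtau \<tau> (Suc n) \<phi>)) + l2 \<Omega> (avg_deriv \<tau> f \<phi> n) (dtau \<tau> (Suc n) \<phi>))"
    unfolding dgrad davg using \<tau> by (simp add: field_simps)
  finally show ?thesis unfolding g1_def u1_def u0_def .
qed

text \<open>The momentum equation is tested with the new velocity itself; the discarded gap is the
  integral of half the square of the velocity increment.\<close>

lemma kinetic_increment:
  fixes v :: "real \<Rightarrow> real^'d \<Rightarrow> 'b::euclidean_space"
  assumes \<tau>: "\<tau> > 0"
    and sq: "square_integrable \<Omega> (nodal \<tau> v (Suc n))" "square_integrable \<Omega> (nodal \<tau> v n)"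
  shows "(LINT x|lebesgue_on \<Omega>. 1/2 * (norm (nodal \<tau> v (Suc n) x))\<^sup>2)
      - (LINT x|lebesgue_on \<Omega>. 1/2 * (norm (nodal \<tau> v n x))\<^sup>2)
    \<le> \<tau> * l2 \<Omega> (dtau \<tau> (Suc n) v) (nodal \<tau> v (Suc n))"
proof -
  define v0 where "v0 = nodal \<tau> v n"
  define v1 where "v1 = nodal \<tau> v (Suc n)"
  have n: "integrable (lebesgue_on \<Omega>) (\<lambda>x. 1/2 * (norm (v0 x))\<^sup>2)" "integrable (lebesgue_on \<Omega>) (\<lambda>x. 1/2 * (norm (v1 x))\<^sup>2)"
    using sq by (auto simp: square_integrable_def v0_def v1_def)
  have i: "integrable (lebesgue_on \<Omega>) (\<lambda>x. v0 x \<bullet> v1 x)" "integrable (lebesgue_on \<Omega>) (\<lambda>x. v1 x \<bullet> v1 x)"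
    using sq by (auto intro: square_integrable_imp_integrable_inner simp: v0_def v1_def)
  have iI: "integrable (lebesgue_on \<Omega>) (\<lambda>x. (v1 x - v0 x) \<bullet> v1 x)"
    unfolding inner_diff_left using i(2,1) by (rule Bochner_Integration.integrable_diff)
  have "(LINT x|lebesgue_on \<Omega>. 1/2 * (norm (v1 x))\<^sup>2) - (LINT x|lebesgue_on \<Omega>. 1/2 * (norm (v0 x))\<^sup>2)
      = (LINT x|lebesgue_on \<Omega>. 1/2 * (norm (v1 x))\<^sup>2 - 1/2 * (norm (v0 x))\<^sup>2)"
    by (rule Bochner_Integration.integral_diff[symmetric, OF n(2,1)])
  also have "\<dots> \<le> (LINT x|lebesgue_on \<Omega>. (v1 x - v0 x) \<bullet> v1 x)"
  proof (rule integral_mono)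
    fix x
    have "1/2 * (norm (v1 x - v0 x))\<^sup>2 \<ge> 0" by simp
    then show "1/2 * (norm (v1 x))\<^sup>2 - 1/2 * (norm (v0 x))\<^sup>2 \<le> (v1 x - v0 x) \<bullet> v1 x"
      by (simp add: power2_norm_eq_inner inner_diff_left inner_diff_right inner_commute algebra_simps)
  qed (intro Bochner_Integration.integrable_diff n iI)+
  also have "\<dots> = \<tau> * l2 \<Omega> (dtau \<tau> (Suc n) v) v1"
    using \<tau> by (simp add: l2_def dtau_def v0_def v1_def)
  finally show ?thesis unfolding v0_def v1_def .
qed

text \<open>Separating the kinetic part lets the Navier-Stokes case reuse the estimate for
  \<open>E0\<close>. As \<open>E1\<close> is one integral, this requires both parts to be
  integrable.\<close>

lemma E1_eq:
  assumes \<Omega>: "periodic_domain \<Lambda> \<Omega>" "periodic_triangulation \<Lambda> \<Omega> Th"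
    and f: "continuous_on UNIV f" and \<phi>: "\<phi> \<in> P_cont k \<Lambda> Th" and v: "square_integrable \<Omega> v"
  shows "E1 \<Omega> \<gamma> f \<phi> v = E0 \<Omega> \<gamma> f \<phi> + (LINT x|lebesgue_on \<Omega>. 1/2 * (norm (v x))\<^sup>2)"
proof -
  note mesh = periodic_mesh_facts[OF \<Omega>]
  have "integrable (lebesgue_on \<Omega>) (\<lambda>x. (norm (weak_grad \<phi> x))\<^sup>2)" "integrable (lebesgue_on \<Omega>) (\<lambda>x. (norm (v x))\<^sup>2)"
    using v P_cont_square_integrable(2)[OF \<phi> mesh(4,5)] by (auto simp: square_integrable_def)
  then show ?thesis
    unfolding E0_def E1_def
    by (intro Bochner_Integration.integral_add Bochner_Integration.integrable_add integrable_mult_right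
        P_cont_comp_integrable[OF \<phi> mesh(1-5) f])
qed

text \<open>Discrete chain rule: testing the equation for the chemical potential with the difference
  quotient of \<open>\<phi>\<close> turns the duality product of that quotient with \<open>\<mu>\<close> into an energy increment.\<close>

lemma phase_field_energy_increment:
  assumes \<Omega>: "periodic_domain \<Lambda> \<Omega>" "periodic_triangulation \<Lambda> \<Omega> Th"
    and \<tau>: "\<tau> > 0" and \<gamma>: "\<gamma> > 0"
    and f: "\<And>s. (f has_real_derivative deriv f s) (at s)"
    and \<phi>: "nodal \<tau> \<phi> (Suc n) \<in> Vh \<Lambda> Th" "nodal \<tau> \<phi> n \<in> Vh \<Lambda> Th"
    and potential: "\<forall>\<xi>\<in>Vh \<Lambda> Th.
         l2 \<Omega> \<mu>1 \<xi> - \<gamma> * l2 \<Omega> (weak_grad (nodal \<tau> \<phi> (Suc n))) (weak_grad \<xi>)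
         - l2 \<Omega> (avg_deriv \<tau> f \<phi> n) \<xi> = 0"
  shows "E0 \<Omega> \<gamma> f (nodal \<tau> \<phi> (Suc n)) - E0 \<Omega> \<gamma> f (nodal \<tau> \<phi> n) \<le> \<tau> * l2 \<Omega> (dtau \<tau> (Suc n) \<phi>) \<mu>1"
proof -
  have "dtau \<tau> (Suc n) \<phi> \<in> Vh \<Lambda> Th"
    using \<phi> unfolding Vh_def by (rule dtau_in_P_cont)
  with potential have "l2 \<Omega> (dtau \<tau> (Suc n) \<phi>) \<mu>1
      = \<gamma> * l2 \<Omega> (weak_grad (nodal \<tau> \<phi> (Suc n))) (weak_grad (dtau \<tau> (Suc n) \<phi>))
        + l2 \<Omega> (avg_deriv \<tau> f \<phi> n) (dtau \<tau> (Suc n) \<phi>)"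
    unfolding l2_commute[of \<Omega> "dtau \<tau> (Suc n) \<phi>" \<mu>1] by (simp add: algebra_simps)
  then show ?thesis
    using E0_increment[OF \<Omega> \<tau> \<gamma> f \<phi>[unfolded Vh_def]] by simp
qed

text \<open>Covers all three schemes: w is the convective flux and w' the diffusive one. Both meet
  only the gradient of the test function, which vanishes almost everywhere for the test function
  1.\<close>

lemma mass_conservation:
  assumes \<Omega>: "periodic_domain \<Lambda> \<Omega>" "periodic_triangulation \<Lambda> \<Omega> Th" and \<tau>: "\<tau> > 0"
    and \<phi>: "nodal \<tau> \<phi> (Suc n) \<in> Vh \<Lambda> Th" "nodal \<tau> \<phi> n \<in> Vh \<Lambda> Th"
    and transport: "\<forall>\<psi>\<in>Vh \<Lambda> Th. l2 \<Omega> (dtau \<tau> (Suc n) \<phi>) \<psi> - l2 \<Omega> w (weak_grad \<psi>)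
      + l2 \<Omega> w' (weak_grad \<psi>) = 0"
  shows "l2 \<Omega> (nodal \<tau> \<phi> (Suc n)) (\<lambda>x. 1) = l2 \<Omega> (nodal \<tau> \<phi> n) (\<lambda>x. 1)"
proof -
  note mesh = periodic_mesh_facts[OF \<Omega>]
  have "integrable (lebesgue_on \<Omega>) u" if "u \<in> Vh \<Lambda> Th" for u
    using that P_cont_square_integrable(1)[OF _ mesh(4,5), of u] mesh(6)
    by (auto simp: Vh_def intro: square_integrable_imp_integrable)
  note int = this[OF \<phi>(1)] this[OF \<phi>(2)]
  have "(\<lambda>x. 1) \<in> Vh \<Lambda> Th"
    unfolding Vh_def by (rule P_cont_const)
  from bspec[OF transport this] have "l2 \<Omega> (dtau \<tau> (Suc n) \<phi>) (\<lambda>x. 1) = 0"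
    by (simp add: l2_weak_grad_const[OF mesh(5)])
  then show ?thesis using dtau_mass[OF int \<tau>] \<tau> by simp
qed

theorem theorem1:
  fixes \<Lambda> \<Omega> :: "(real^'d) set"
    and Th :: "(real^'d) set set"
    and \<sigma> T \<tau> \<gamma> :: real
    and N :: nat
    and f m \<alpha> \<eta> :: "real \<Rightarrow> real"
  assumes "CARD('d) \<in> {2, 3}"
    and "periodic_domain \<Lambda> \<Omega>"
    and "periodic_triangulation \<Lambda> \<Omega> Th"
    and "\<sigma> > 0" and "quasi_uniform \<sigma> Th"
    and "T > 0" and "\<tau> > 0" and "T / \<tau> = real N"
    and "\<gamma> > 0"
    and "f C1_differentiable_on UNIV"
    and "continuous_on UNIV m" and "continuous_on UNIV \<alpha>" and "continuous_on UNIV \<eta>"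
  shows "(\<forall>\<phi>0\<in>Vh \<Lambda> Th. \<forall>\<phi> \<mu>. CH_scheme \<Lambda> \<Omega> Th \<tau> N \<gamma> f m \<phi>0 \<phi> \<mu> \<longrightarrow>
      (\<forall>n<N. let \<phi>1 = nodal \<tau> \<phi> (Suc n); \<mu>1 = midval \<tau> \<mu> (Suc n) in
         l2 \<Omega> \<phi>1 (\<lambda>x. 1) = l2 \<Omega> (nodal \<tau> \<phi> n) (\<lambda>x. 1) \<and>
         E0 \<Omega> \<gamma> f \<phi>1
           + \<tau> * l2 \<Omega> (\<lambda>x. m (\<phi>1 x) *\<^sub>R weak_grad \<mu>1 x) (weak_grad \<mu>1)
           \<le> E0 \<Omega> \<gamma> f (nodal \<tau> \<phi> n)))
    \<and> (\<forall>\<phi>0\<in>Vh \<Lambda> Th. \<forall>\<phi> \<mu> v p. CHD_scheme \<Lambda> \<Omega> Th \<tau> N \<gamma> f m \<alpha> \<phi>0 \<phi> \<mu> v p \<longrightarrow>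
      (\<forall>n<N. let \<phi>1 = nodal \<tau> \<phi> (Suc n); \<mu>1 = midval \<tau> \<mu> (Suc n); v1 = midval \<tau> v (Suc n) in
         l2 \<Omega> \<phi>1 (\<lambda>x. 1) = l2 \<Omega> (nodal \<tau> \<phi> n) (\<lambda>x. 1) \<and>
         E0 \<Omega> \<gamma> f \<phi>1
           + \<tau> * l2 \<Omega> (\<lambda>x. m (\<phi>1 x) *\<^sub>R weak_grad \<mu>1 x) (weak_grad \<mu>1)
           + \<tau> * l2 \<Omega> (\<lambda>x. \<alpha> (\<phi>1 x) *\<^sub>R v1 x) v1
           \<le> E0 \<Omega> \<gamma> f (nodal \<tau> \<phi> n)))
    \<and> (\<forall>\<phi>0\<in>Vh \<Lambda> Th. \<forall>v0\<in>Xh \<Lambda> Th. \<forall>\<phi> \<mu> v p.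
      CHNS_scheme \<Lambda> \<Omega> Th \<tau> N \<gamma> f m \<eta> \<phi>0 v0 \<phi> \<mu> v p \<longrightarrow>
      (\<forall>n<N. let \<phi>1 = nodal \<tau> \<phi> (Suc n); \<mu>1 = midval \<tau> \<mu> (Suc n); v1 = nodal \<tau> v (Suc n) in
         l2 \<Omega> \<phi>1 (\<lambda>x. 1) = l2 \<Omega> (nodal \<tau> \<phi> n) (\<lambda>x. 1) \<and>
         E1 \<Omega> \<gamma> f \<phi>1 v1
           + \<tau> * l2 \<Omega> (\<lambda>x. m (\<phi>1 x) *\<^sub>R weak_grad \<mu>1 x) (weak_grad \<mu>1)
           + \<tau> * l2 \<Omega> (\<lambda>x. \<eta> (\<phi>1 x) *\<^sub>R sym_grad v1 x) (sym_grad v1)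
           \<le> E1 \<Omega> \<gamma> f (nodal \<tau> \<phi> n) (nodal \<tau> v n)))"
proof -
  note \<Omega> = assms(2,3) and \<tau> = \<open>\<tau> > 0\<close> and \<gamma> = \<open>\<gamma> > 0\<close>
  note mesh = periodic_mesh_facts[OF \<Omega>]
  have f: "(f has_real_derivative deriv f s) (at s)" for s
    using assms(10) by (simp add: C1_differentiable_on_eq DERIV_deriv_iff_real_differentiable)
  then have f_cont: "continuous_on UNIV f"
    using DERIV_isCont by (auto simp: continuous_on_eq_continuous_at)
  have CH: "l2 \<Omega> (nodal \<tau> \<phi> (Suc n)) (\<lambda>x. 1) = l2 \<Omega> (nodal \<tau> \<phi> n) (\<lambda>x. 1) \<and>
         E0 \<Omega> \<gamma> f (nodal \<tau> \<phi> (Suc n))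
           + \<tau> * l2 \<Omega> (\<lambda>x. m (nodal \<tau> \<phi> (Suc n) x) *\<^sub>R weak_grad (midval \<tau> \<mu> (Suc n)) x) (weak_grad (midval \<tau> \<mu> (Suc n)))
           \<le> E0 \<Omega> \<gamma> f (nodal \<tau> \<phi> n)"
    if scheme: "CH_scheme \<Lambda> \<Omega> Th \<tau> N \<gamma> f m \<phi>0 \<phi> \<mu>" and n: "n < N" for \<phi>0 \<phi> \<mu> n
  proof -
    have spaces: "\<phi> \<in> Pi1c \<Omega> \<tau> N (Vh \<Lambda> Th)" "\<mu> \<in> Pi0 \<Omega> \<tau> N (Vh \<Lambda> Th)"
      using scheme by (auto simp: CH_scheme_def)
    have \<phi>: "nodal \<tau> \<phi> (Suc n) \<in> Vh \<Lambda> Th" "nodal \<tau> \<phi> n \<in> Vh \<Lambda> Th"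
      using n by (auto intro!: nodal_in_Pi1c[OF spaces(1) \<tau>])
    have \<mu>: "midval \<tau> \<mu> (Suc n) \<in> Vh \<Lambda> Th"
      by (rule midval_in_Pi0[OF spaces(2) \<tau> n])
    \<comment> \<open>Without a velocity the convective flux is 0; it is inserted to match the
      common form in \<open>mass_conservation\<close>.\<close>
    have transport: "\<forall>\<psi>\<in>Vh \<Lambda> Th. l2 \<Omega> (dtau \<tau> (Suc n) \<phi>) \<psi> - l2 \<Omega> (\<lambda>x. 0) (weak_grad \<psi>)
         + l2 \<Omega> (\<lambda>x. m (nodal \<tau> \<phi> (Suc n) x) *\<^sub>R weak_grad (midval \<tau> \<mu> (Suc n)) x) (weak_grad \<psi>) = 0"
      using scheme n by (simp add: CH_scheme_def Let_def l2_def[of _ "\<lambda>x. 0"])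
    have potential: "\<forall>\<xi>\<in>Vh \<Lambda> Th. l2 \<Omega> (midval \<tau> \<mu> (Suc n)) \<xi>
         - \<gamma> * l2 \<Omega> (weak_grad (nodal \<tau> \<phi> (Suc n))) (weak_grad \<xi>) - l2 \<Omega> (avg_deriv \<tau> f \<phi> n) \<xi> = 0"
      using scheme n by (simp add: CH_scheme_def Let_def)
    have dis: "l2 \<Omega> (dtau \<tau> (Suc n) \<phi>) (midval \<tau> \<mu> (Suc n))
        = - l2 \<Omega> (\<lambda>x. m (nodal \<tau> \<phi> (Suc n) x) *\<^sub>R weak_grad (midval \<tau> \<mu> (Suc n)) x) (weak_grad (midval \<tau> \<mu> (Suc n)))"
      using bspec[OF transport \<mu>] by (simp add: l2_def[of _ "\<lambda>x. 0"])
    show ?thesis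
      using mass_conservation[OF \<Omega> \<tau> \<phi> transport]
        phase_field_energy_increment[OF \<Omega> \<tau> \<gamma> f \<phi> potential] unfolding dis by simp
  qed
  have CHD: "l2 \<Omega> (nodal \<tau> \<phi> (Suc n)) (\<lambda>x. 1) = l2 \<Omega> (nodal \<tau> \<phi> n) (\<lambda>x. 1) \<and>
         E0 \<Omega> \<gamma> f (nodal \<tau> \<phi> (Suc n))
           + \<tau> * l2 \<Omega> (\<lambda>x. m (nodal \<tau> \<phi> (Suc n) x) *\<^sub>R weak_grad (midval \<tau> \<mu> (Suc n)) x) (weak_grad (midval \<tau> \<mu> (Suc n)))
           + \<tau> * l2 \<Omega> (\<lambda>x. \<alpha> (nodal \<tau> \<phi> (Suc n) x) *\<^sub>R midval \<tau> v (Suc n) x) (midval \<tau> v (Suc n))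
           \<le> E0 \<Omega> \<gamma> f (nodal \<tau> \<phi> n)"
    if scheme: "CHD_scheme \<Lambda> \<Omega> Th \<tau> N \<gamma> f m \<alpha> \<phi>0 \<phi> \<mu> v p" and n: "n < N" for \<phi>0 \<phi> \<mu> v p n
  proof -
    define \<phi>1 where "\<phi>1 = nodal \<tau> \<phi> (Suc n)"
    define \<mu>1 where "\<mu>1 = midval \<tau> \<mu> (Suc n)"
    define v1 where "v1 = midval \<tau> v (Suc n)"
    define p1 where "p1 = midval \<tau> p (Suc n)"
    have spaces: "\<phi> \<in> Pi1c \<Omega> \<tau> N (Vh \<Lambda> Th)" "\<mu> \<in> Pi0 \<Omega> \<tau> N (Vh \<Lambda> Th)"
        "v \<in> Pi0 \<Omega> \<tau> N (Zh \<Lambda> Th)" "p \<in> Pi0 \<Omega> \<tau> N (Wh \<Omega> Th)"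
      using scheme by (auto simp: CHD_scheme_def)
    have \<phi>: "nodal \<tau> \<phi> (Suc n) \<in> Vh \<Lambda> Th" "nodal \<tau> \<phi> n \<in> Vh \<Lambda> Th"
      using n by (auto intro!: nodal_in_Pi1c[OF spaces(1) \<tau>])
    have \<mu>: "\<mu>1 \<in> Vh \<Lambda> Th" and v: "v1 \<in> Zh \<Lambda> Th" and p: "p1 \<in> Wh \<Omega> Th"
      unfolding \<mu>1_def v1_def p1_def using spaces(2-4) by (auto intro: midval_in_Pi0[OF _ \<tau> n])
    have transport: "\<forall>\<psi>\<in>Vh \<Lambda> Th. l2 \<Omega> (dtau \<tau> (Suc n) \<phi>) \<psi> - l2 \<Omega> (\<lambda>x. \<phi>1 x *\<^sub>R v1 x) (weak_grad \<psi>)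
         + l2 \<Omega> (\<lambda>x. m (\<phi>1 x) *\<^sub>R weak_grad \<mu>1 x) (weak_grad \<psi>) = 0"
      and potential: "\<forall>\<xi>\<in>Vh \<Lambda> Th. l2 \<Omega> \<mu>1 \<xi>
         - \<gamma> * l2 \<Omega> (weak_grad (nodal \<tau> \<phi> (Suc n))) (weak_grad \<xi>) - l2 \<Omega> (avg_deriv \<tau> f \<phi> n) \<xi> = 0"
      and momentum: "\<forall>w\<in>Zh \<Lambda> Th. l2 \<Omega> (\<lambda>x. \<alpha> (\<phi>1 x) *\<^sub>R v1 x) w - l2 \<Omega> p1 (weak_div w)
         + l2 \<Omega> (\<lambda>x. \<phi>1 x *\<^sub>R weak_grad \<mu>1 x) w = 0"
      and incompressible: "\<forall>q\<in>Wh \<Omega> Th. l2 \<Omega> (weak_div v1) q = 0"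
      using scheme n unfolding CHD_scheme_def Let_def \<phi>1_def \<mu>1_def v1_def p1_def by blast+
    \<comment> \<open>The transport term tested with \<mu> and the capillary force tested with the
      velocity have the same integrand. They enter with opposite signs and disappear when the two
      equations are combined.\<close>
    have coupling: "l2 \<Omega> (\<lambda>x. \<phi>1 x *\<^sub>R v1 x) (weak_grad \<mu>1) = l2 \<Omega> (\<lambda>x. \<phi>1 x *\<^sub>R weak_grad \<mu>1 x) v1"
      by (simp add: l2_def inner_commute)
    \<comment> \<open>The pressure is itself an admissible test function in the divergence
      constraint, and both equations refer to the same choice \<open>weak_div v1\<close>.\<close>
    have "l2 \<Omega> p1 (weak_div v1) = 0"
      using bspec[OF incompressible p] by (simp add: l2_commute)
    then have "l2 \<Omega> (dtau \<tau> (Suc n) \<phi>) \<mu>1 = - l2 \<Omega> (\<lambda>x. m (\<phi>1 x) *\<^sub>R weak_grad \<mu>1 x) (weak_grad \<mu>1)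
        - l2 \<Omega> (\<lambda>x. \<alpha> (\<phi>1 x) *\<^sub>R v1 x) v1"
      using bspec[OF transport \<mu>] bspec[OF momentum v] coupling by linarith
    \<comment> \<open>The energy increment is bounded by \<tau> times the pairing, so the balance is
      multiplied by \<tau> before the two are combined linearly.\<close>
    then have "\<tau> * l2 \<Omega> (dtau \<tau> (Suc n) \<phi>) \<mu>1 = - (\<tau> * l2 \<Omega> (\<lambda>x. m (\<phi>1 x) *\<^sub>R weak_grad \<mu>1 x) (weak_grad \<mu>1))
        - \<tau> * l2 \<Omega> (\<lambda>x. \<alpha> (\<phi>1 x) *\<^sub>R v1 x) v1"
      by (simp add: right_diff_distrib)
    then show ?thesis
      using mass_conservation[OF \<Omega> \<tau> \<phi> transport]
        phase_field_energy_increment[OF \<Omega> \<tau> \<gamma> f \<phi> potential]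
      unfolding \<phi>1_def \<mu>1_def v1_def by linarith
  qed
  have CHNS: "l2 \<Omega> (nodal \<tau> \<phi> (Suc n)) (\<lambda>x. 1) = l2 \<Omega> (nodal \<tau> \<phi> n) (\<lambda>x. 1) \<and>
         E1 \<Omega> \<gamma> f (nodal \<tau> \<phi> (Suc n)) (nodal \<tau> v (Suc n))
           + \<tau> * l2 \<Omega> (\<lambda>x. m (nodal \<tau> \<phi> (Suc n) x) *\<^sub>R weak_grad (midval \<tau> \<mu> (Suc n)) x) (weak_grad (midval \<tau> \<mu> (Suc n)))
           + \<tau> * l2 \<Omega> (\<lambda>x. \<eta> (nodal \<tau> \<phi> (Suc n) x) *\<^sub>R sym_grad (nodal \<tau> v (Suc n)) x) (sym_grad (nodal \<tau> v (Suc n)))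
           \<le> E1 \<Omega> \<gamma> f (nodal \<tau> \<phi> n) (nodal \<tau> v n)"
    if scheme: "CHNS_scheme \<Lambda> \<Omega> Th \<tau> N \<gamma> f m \<eta> \<phi>0 v0 \<phi> \<mu> v p" and n: "n < N" for \<phi>0 v0 \<phi> \<mu> v p n
  proof -
    define \<phi>1 where "\<phi>1 = nodal \<tau> \<phi> (Suc n)"
    define \<mu>1 where "\<mu>1 = midval \<tau> \<mu> (Suc n)"
    define v1 where "v1 = nodal \<tau> v (Suc n)"
    define p1 where "p1 = midval \<tau> p (Suc n)"
    have spaces: "\<phi> \<in> Pi1c \<Omega> \<tau> N (Vh \<Lambda> Th)" "v \<in> Pi1c \<Omega> \<tau> N (Xh \<Lambda> Th)"
        "\<mu> \<in> Pi0 \<Omega> \<tau> N (Vh \<Lambda> Th)" "p \<in> Pi0 \<Omega> \<tau> N (Qh \<Lambda> Th)"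
      using scheme by (auto simp: CHNS_scheme_def)
    have \<phi>: "nodal \<tau> \<phi> (Suc n) \<in> Vh \<Lambda> Th" "nodal \<tau> \<phi> n \<in> Vh \<Lambda> Th"
      using n by (auto intro!: nodal_in_Pi1c[OF spaces(1) \<tau>])
    have v: "nodal \<tau> v (Suc n) \<in> Xh \<Lambda> Th" "nodal \<tau> v n \<in> Xh \<Lambda> Th"
      using n by (auto intro!: nodal_in_Pi1c[OF spaces(2) \<tau>])
    have \<mu>: "\<mu>1 \<in> Vh \<Lambda> Th" and p: "p1 \<in> Qh \<Lambda> Th"
      unfolding \<mu>1_def p1_def using spaces(3-4) by (auto intro: midval_in_Pi0[OF _ \<tau> n])
    have transport: "\<forall>\<psi>\<in>Vh \<Lambda> Th. l2 \<Omega> (dtau \<tau> (Suc n) \<phi>) \<psi> - l2 \<Omega> (\<lambda>x. \<phi>1 x *\<^sub>R v1 x) (weak_grad \<psi>)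
         + l2 \<Omega> (\<lambda>x. m (\<phi>1 x) *\<^sub>R weak_grad \<mu>1 x) (weak_grad \<psi>) = 0"
      and potential: "\<forall>\<xi>\<in>Vh \<Lambda> Th. l2 \<Omega> \<mu>1 \<xi>
         - \<gamma> * l2 \<Omega> (weak_grad (nodal \<tau> \<phi> (Suc n))) (weak_grad \<xi>) - l2 \<Omega> (avg_deriv \<tau> f \<phi> n) \<xi> = 0"
      and momentum: "\<forall>w\<in>Xh \<Lambda> Th. l2 \<Omega> (dtau \<tau> (Suc n) v) w + c_skw \<Omega> v1 v1 w
         + l2 \<Omega> (\<lambda>x. \<eta> (\<phi>1 x) *\<^sub>R sym_grad v1 x) (sym_grad w) - l2 \<Omega> p1 (weak_div w)
         + l2 \<Omega> (\<lambda>x. \<phi>1 x *\<^sub>R weak_grad \<mu>1 x) w = 0"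
      and incompressible: "\<forall>q\<in>Qh \<Lambda> Th. l2 \<Omega> (weak_div v1) q = 0"
      using scheme n unfolding CHNS_scheme_def Let_def \<phi>1_def \<mu>1_def v1_def p1_def by blast+
    have coupling: "l2 \<Omega> (\<lambda>x. \<phi>1 x *\<^sub>R v1 x) (weak_grad \<mu>1) = l2 \<Omega> (\<lambda>x. \<phi>1 x *\<^sub>R weak_grad \<mu>1 x) v1"
      by (simp add: l2_def inner_commute)
    \<comment> \<open>With equal second and third arguments the two halves of the form are the same
      integral, so convection does no work.\<close>
    have skew: "c_skw \<Omega> v1 v1 v1 = 0"
      by (simp add: c_skw_def)
    have "l2 \<Omega> p1 (weak_div v1) = 0"
      using bspec[OF incompressible p] by (simp add: l2_commute)
    \<comment> \<open>Adding the phase field equation tested with \<mu> to the momentum equation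
      tested with the new velocity leaves, besides the two difference quotients, only the two
      dissipation terms.\<close>
    then have "l2 \<Omega> (dtau \<tau> (Suc n) \<phi>) \<mu>1 + l2 \<Omega> (dtau \<tau> (Suc n) v) v1
        = - l2 \<Omega> (\<lambda>x. m (\<phi>1 x) *\<^sub>R weak_grad \<mu>1 x) (weak_grad \<mu>1)
          - l2 \<Omega> (\<lambda>x. \<eta> (\<phi>1 x) *\<^sub>R sym_grad v1 x) (sym_grad v1)"
      using bspec[OF transport \<mu>] bspec[OF momentum v(1)[folded v1_def]] coupling skew by linarith
    then have "\<tau> * (l2 \<Omega> (dtau \<tau> (Suc n) \<phi>) \<mu>1 + l2 \<Omega> (dtau \<tau> (Suc n) v) v1)
        = \<tau> * (- l2 \<Omega> (\<lambda>x. m (\<phi>1 x) *\<^sub>R weak_grad \<mu>1 x) (weak_grad \<mu>1)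
          - l2 \<Omega> (\<lambda>x. \<eta> (\<phi>1 x) *\<^sub>R sym_grad v1 x) (sym_grad v1))"
      by (rule arg_cong)
    then have dis: "\<tau> * l2 \<Omega> (dtau \<tau> (Suc n) \<phi>) \<mu>1 + \<tau> * l2 \<Omega> (dtau \<tau> (Suc n) v) v1
        = - (\<tau> * l2 \<Omega> (\<lambda>x. m (\<phi>1 x) *\<^sub>R weak_grad \<mu>1 x) (weak_grad \<mu>1))
          - \<tau> * l2 \<Omega> (\<lambda>x. \<eta> (\<phi>1 x) *\<^sub>R sym_grad v1 x) (sym_grad v1)"
      by (simp only: distrib_left right_diff_distrib mult_minus_right)
    note sq = Xh_square_integrable[OF v(1) mesh(4,5)] Xh_square_integrable[OF v(2) mesh(4,5)]
    show ?thesis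
      using mass_conservation[OF \<Omega> \<tau> \<phi> transport] dis
        phase_field_energy_increment[OF \<Omega> \<tau> \<gamma> f \<phi> potential] kinetic_increment[OF \<tau> sq]
        E1_eq[OF \<Omega> f_cont \<phi>(1)[unfolded Vh_def] sq(1), of \<gamma>]
        E1_eq[OF \<Omega> f_cont \<phi>(2)[unfolded Vh_def] sq(2), of \<gamma>]
      unfolding \<phi>1_def \<mu>1_def v1_def by linarith
  qed
  show ?thesis
    unfolding Let_def using CH CHD CHNS by blast
qed

end
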